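(* Let $\Bbbk$ be a field, let $H$ be a cocommutative Hopf algebra over $\Bbbk$, and let $M$ be a left $H$-module coalgebra. Let $F\le H$ be a finite-dimensional subcoalgebra and let $0\neq E\le M$ be a finite-dimensional subspace. Then there exists a nonzero finite-dimensional subcoalgebra $C\le M$ such that \[\frac{\dim(C+FC)}{\dim C}\le\frac{\dim(E+FE)}{\dim E}.\]
   Context: A left $H$-module coalgebra is a coalgebra $M$ endowed with a left $H$-module structure such that $\Delta(hm)=\sum h_{(1)}m_{(1)}\otimes h_{(2)}m_{(2)}$ and $\varepsilon(hm)=\varepsilon(h)\varepsilon(m)$ for all $h\in H$, $m\in M$. For subspaces $A\le H$ and $V\le M$, $AV$ denotes the $\Bbbk$-linear span of $\{av:a\in A,v\in V\}$. *)

theory Defs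
  imports Complex_Main "HOL-Library.Poly_Mapping" "HOL-Library.Set_Algebras"
begin

text \<open>
  As in \<^theory>\<open>HOL.Vector_Spaces\<close>, a vector space is a type of class \<^class>\<open>ab_group_add\<close> with an
  explicit scalar multiplication by a \<^class>\<open>field\<close>. The tensor powers \<open>A \<otimes> A\<close> and \<open>A \<otimes> A \<otimes> A\<close> are
  the usual quotients of the free vector spaces on \<open>A \<times> A\<close> and \<open>A \<times> A \<times> A\<close>. The free vector space
  on \<open>'x\<close> is \<open>'x \<Rightarrow>\<^sub>0 'k\<close>, with basis vectors \<open>Poly_Mapping.single x 1\<close>.
\<close>

definition free_scale :: "'k::field \<Rightarrow> ('x \<Rightarrow>\<^sub>0 'k) \<Rightarrow> ('x \<Rightarrow>\<^sub>0 'k)" where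
  "free_scale c = Poly_Mapping.map (\<lambda>r. c * r)"

text \<open>The linear extension of \<open>\<phi>\<close> from the basis to the free vector space:\<close>

definition lin_ext :: "('k::field \<Rightarrow> 'v::ab_group_add \<Rightarrow> 'v) \<Rightarrow> ('x \<Rightarrow> 'v) \<Rightarrow> ('x \<Rightarrow>\<^sub>0 'k) \<Rightarrow> 'v" where
  "lin_ext scale \<phi> f =
     (\<Sum>x\<in>Poly_Mapping.keys f. scale (Poly_Mapping.lookup f x) (\<phi> x))"

abbreviation pair_tensor :: "'a \<Rightarrow> 'a \<Rightarrow> ('a \<times> 'a \<Rightarrow>\<^sub>0 'k::field)" where
  "pair_tensor a b \<equiv> Poly_Mapping.single (a, b) 1"

abbreviation triple_tensor :: "'a \<Rightarrow> 'a \<Rightarrow> 'a \<Rightarrow> ('a \<times> 'a \<times> 'a \<Rightarrow>\<^sub>0 'k::field)" where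
  "triple_tensor a b c \<equiv> Poly_Mapping.single (a, b, c) 1"

definition bilinear_relations ::
    "('k::field \<Rightarrow> 'a::ab_group_add \<Rightarrow> 'a) \<Rightarrow> ('a \<times> 'a \<Rightarrow>\<^sub>0 'k) set" where
  "bilinear_relations scale = module.span free_scale
     ({pair_tensor (a + a') b - pair_tensor a b - pair_tensor a' b | a a' b. True} \<union>
      {pair_tensor a (b + b') - pair_tensor a b - pair_tensor a b' | a b b'. True} \<union>
      {pair_tensor (scale r a) b - free_scale r (pair_tensor a b) | r a b. True} \<union>
      {pair_tensor a (scale r b) - free_scale r (pair_tensor a b) | r a b. True})"

definition trilinear_relations ::
    "('k::field \<Rightarrow> 'a::ab_group_add \<Rightarrow> 'a) \<Rightarrow> ('a \<times> 'a \<times> 'a \<Rightarrow>\<^sub>0 'k) set" where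
  "trilinear_relations scale = module.span free_scale
     ({triple_tensor (a + a') b c - triple_tensor a b c - triple_tensor a' b c | a a' b c. True} \<union>
      {triple_tensor a (b + b') c - triple_tensor a b c - triple_tensor a b' c | a b b' c. True} \<union>
      {triple_tensor a b (c + c') - triple_tensor a b c - triple_tensor a b c' | a b c c'. True} \<union>
      {triple_tensor (scale r a) b c - free_scale r (triple_tensor a b c) | r a b c. True} \<union>
      {triple_tensor a (scale r b) c - free_scale r (triple_tensor a b c) | r a b c. True} \<union>
      {triple_tensor a b (scale r c) - free_scale r (triple_tensor a b c) | r a b c. True})"

definition tensor_square ::
    "('k::field \<Rightarrow> 'a::ab_group_add \<Rightarrow> 'a) \<Rightarrow> ('a \<times> 'a \<Rightarrow>\<^sub>0 'k) set set" where
  "tensor_square scale = range (\<lambda>f. f +o bilinear_relations scale)"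

text \<open>
  Elements of \<open>A \<otimes> A\<close> are thus cosets, and \<open>f \<in> \<Delta> x\<close> says that the formal sum \<open>f\<close> represents \<open>\<Delta> x\<close>,
  i.e. is one of the expressions \<open>\<Sum> x\<^sub>(\<^sub>1\<^sub>) \<otimes> x\<^sub>(\<^sub>2\<^sub>)\<close> of Sweedler notation. As distinct cosets are disjoint,
  \<open>f + g \<in> \<Delta> (x + y)\<close> below expresses \<open>\<Delta> x + \<Delta> y = \<Delta> (x + y)\<close> in \<open>A \<otimes> A\<close>. In \<open>coassoc\<close>, \<open>\<delta>\<close> chooses
  a representative of \<open>\<Delta> a\<close> for every \<open>a\<close>.
\<close>

locale coalgebra = vector_space scale
  for scale :: "'k::field \<Rightarrow> 'a::ab_group_add \<Rightarrow> 'a" +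
  fixes \<Delta> :: "'a \<Rightarrow> ('a \<times> 'a \<Rightarrow>\<^sub>0 'k) set"
    and \<epsilon> :: "'a \<Rightarrow> 'k"
  assumes comult_in_tensor_square: "\<Delta> x \<in> tensor_square scale"
    and comult_add: "f \<in> \<Delta> x \<Longrightarrow> g \<in> \<Delta> y \<Longrightarrow> f + g \<in> \<Delta> (x + y)"
    and comult_scale: "f \<in> \<Delta> x \<Longrightarrow> free_scale r f \<in> \<Delta> (scale r x)"
    and counit_linear: "Vector_Spaces.linear scale (*) \<epsilon>"
    and coassoc: "(\<And>a. \<delta> a \<in> \<Delta> a) \<Longrightarrow>
      lin_ext free_scale (\<lambda>(a, b). lin_ext free_scale (\<lambda>(a1, a2). triple_tensor a1 a2 b) (\<delta> a)) (\<delta> x)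
      - lin_ext free_scale (\<lambda>(a, b). lin_ext free_scale (\<lambda>(b1, b2). triple_tensor a b1 b2) (\<delta> b)) (\<delta> x)
      \<in> trilinear_relations scale"
    and counit_left: "f \<in> \<Delta> x \<Longrightarrow> lin_ext scale (\<lambda>(a, b). scale (\<epsilon> a) b) f = x"
    and counit_right: "f \<in> \<Delta> x \<Longrightarrow> lin_ext scale (\<lambda>(a, b). scale (\<epsilon> b) a) f = x"

definition cocommutative :: "('a \<Rightarrow> ('a \<times> 'a \<Rightarrow>\<^sub>0 'k::field) set) \<Rightarrow> bool" where
  "cocommutative \<Delta> \<longleftrightarrow>
     (\<forall>x. \<forall>f\<in>\<Delta> x. lin_ext free_scale (\<lambda>(a, b). pair_tensor b a) f \<in> \<Delta> x)"

text \<open>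
  The class \<^class>\<open>ring_1\<close> includes \<open>0 \<noteq> 1\<close>, which is no restriction for a bialgebra because
  \<open>\<epsilon> 1 = 1\<close>.
\<close>

locale bialgebra = coalgebra scale \<Delta> \<epsilon>
  for scale :: "'k::field \<Rightarrow> 'h::ring_1 \<Rightarrow> 'h" and \<Delta> \<epsilon> +
  assumes scale_mult_left: "scale r x * y = scale r (x * y)"
    and scale_mult_right: "x * scale r y = scale r (x * y)"
    and comult_one: "pair_tensor 1 1 \<in> \<Delta> 1"
    and comult_mult: "f \<in> \<Delta> x \<Longrightarrow> g \<in> \<Delta> y \<Longrightarrow>
      lin_ext free_scale (\<lambda>(x1, x2).
        lin_ext free_scale (\<lambda>(y1, y2). pair_tensor (x1 * y1) (x2 * y2)) g) f \<in> \<Delta> (x * y)"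
    and counit_one: "\<epsilon> 1 = 1"
    and counit_mult: "\<epsilon> (x * y) = \<epsilon> x * \<epsilon> y"

locale hopf_algebra = bialgebra scale \<Delta> \<epsilon>
  for scale :: "'k::field \<Rightarrow> 'h::ring_1 \<Rightarrow> 'h" and \<Delta> \<epsilon> +
  fixes S :: "'h \<Rightarrow> 'h"
  assumes antipode_linear: "Vector_Spaces.linear scale scale S"
    and antipode_left: "f \<in> \<Delta> x \<Longrightarrow> lin_ext scale (\<lambda>(a, b). S a * b) f = scale (\<epsilon> x) 1"
    and antipode_right: "f \<in> \<Delta> x \<Longrightarrow> lin_ext scale (\<lambda>(a, b). a * S b) f = scale (\<epsilon> x) 1"

locale module_coalgebra =
  H: bialgebra scaleH \<Delta>H \<epsilon>H + M: coalgebra scaleM \<Delta>M \<epsilon>M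
  for scaleH :: "'k::field \<Rightarrow> 'h::ring_1 \<Rightarrow> 'h" and \<Delta>H \<epsilon>H
    and scaleM :: "'k \<Rightarrow> 'm::ab_group_add \<Rightarrow> 'm" and \<Delta>M \<epsilon>M +
  fixes act :: "'h \<Rightarrow> 'm \<Rightarrow> 'm"
  assumes act_linear_left: "Vector_Spaces.linear scaleH scaleM (\<lambda>h. act h m)"
    and act_linear_right: "Vector_Spaces.linear scaleM scaleM (act h)"
    and act_one: "act 1 m = m"
    and act_mult: "act (h * h') m = act h (act h' m)"
    and comult_act: "f \<in> \<Delta>H h \<Longrightarrow> g \<in> \<Delta>M m \<Longrightarrow>
      lin_ext free_scale (\<lambda>(h1, h2).
        lin_ext free_scale (\<lambda>(m1, m2). pair_tensor (act h1 m1) (act h2 m2)) g) f \<in> \<Delta>M (act h m)"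
    and counit_act: "\<epsilon>M (act h m) = \<epsilon>H h * \<epsilon>M m"

text \<open>
  \<open>\<Delta> C \<subseteq> C \<otimes> C\<close>, where \<open>C \<otimes> C\<close> is identified with its image in \<open>A \<otimes> A\<close>: the cosets that contain a
  formal sum supported on \<open>C \<times> C\<close>.
\<close>

definition subcoalgebra ::
    "('k::field \<Rightarrow> 'a::ab_group_add \<Rightarrow> 'a) \<Rightarrow> ('a \<Rightarrow> ('a \<times> 'a \<Rightarrow>\<^sub>0 'k) set) \<Rightarrow> 'a set \<Rightarrow> bool" where
  "subcoalgebra scale \<Delta> C \<longleftrightarrow>
     module.subspace scale C \<and> (\<forall>c\<in>C. \<exists>f\<in>\<Delta> c. Poly_Mapping.keys f \<subseteq> C \<times> C)"

definition finite_dimensional :: "('k::field \<Rightarrow> 'a::ab_group_add \<Rightarrow> 'a) \<Rightarrow> 'a set \<Rightarrow> bool" where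
  "finite_dimensional scale V \<longleftrightarrow> (\<exists>B. finite B \<and> V = module.span scale B)"

definition act_span ::
    "('k::field \<Rightarrow> 'm::ab_group_add \<Rightarrow> 'm) \<Rightarrow> ('h \<Rightarrow> 'm \<Rightarrow> 'm) \<Rightarrow> 'h set \<Rightarrow> 'm set \<Rightarrow> 'm set" where
  "act_span scaleM act A V = module.span scaleM {act a v | a v. a \<in> A \<and> v \<in> V}"

end

theory Submission
  imports Defs "HOL-Library.Function_Algebras"
begin

text \<open>
  For real \<open>t\<close> let \<open>C\<^sub>t(E)\<close> maximize \<open>dim (E \<inter> C) - t dim C\<close> over the finite-dimensional subcoalgebras
  \<open>C\<close> of \<open>M\<close>, and put \<open>E' = E + FE\<close>. The maximal value is \<open>dim E\<close> at \<open>t = 0\<close>, vanishes at \<open>t = 1\<close> and has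
  slope \<open>- dim C\<^sub>t(E)\<close>, so \<open>dim C\<^sub>t(E)\<close> integrates to \<open>dim E\<close> over \<open>[0, 1]\<close>, and likewise for \<open>E'\<close>. If
  \<open>C\<^sub>t(E) + F C\<^sub>t(E) \<subseteq> C\<^sub>s(E')\<close> for all \<open>s < t\<close>, then \<open>dim (C\<^sub>t(E) + F C\<^sub>t(E))\<close> integrates to at most
  \<open>dim E'\<close>, and some nonzero \<open>C\<^sub>t(E)\<close> is as required. The integrals are replaced by sums over
  \<open>t = k / N\<close>, and the maximized quantity by the integer \<open>N dim (E \<inter> C) - k dim C\<close>.

  For the inclusion, subcoalgebras are regarded as the subspaces stable under all contractions
  \<open>m \<mapsto> f(m\<^sub>(\<^sub>1\<^sub>)) m\<^sub>(\<^sub>2\<^sub>)\<close> and \<open>m \<mapsto> f(m\<^sub>(\<^sub>2\<^sub>)) m\<^sub>(\<^sub>1\<^sub>)\<close> with \<open>f \<in> M\<^sup>*\<close>. On \<open>F \<otimes> M = M\<^sup>I\<close>, where \<open>I\<close> is a basis of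
  \<open>F\<close>, the map \<open>g(h \<otimes> m) = h\<^sub>(\<^sub>1\<^sub>) \<otimes> h\<^sub>(\<^sub>2\<^sub>)m\<close> is injective because of the antipode; it sends \<open>F \<otimes> E\<close> into
  \<open>F \<otimes> E'\<close>, and cocommutativity makes \<open>W = g(F \<otimes> C)\<close> and \<open>{v \<in> F \<otimes> C. g v \<in> F \<otimes> C'}\<close> stable for
  subcoalgebras \<open>C\<close>, \<open>C'\<close>. A coordinate flag of \<open>M\<^sup>I\<close> shows that \<open>F \<otimes> C\<^sub>t(E)\<close> is a maximizer among all
  stable subspaces of \<open>M\<^sup>I\<close>. Comparing \<open>F \<otimes> C'\<close> with \<open>W + F \<otimes> C'\<close>, and \<open>F \<otimes> C\<close> with the preimage, for
  \<open>C = C\<^sub>t(E)\<close>, \<open>C' = C\<^sub>s(E')\<close> and \<open>s < t\<close>, supermodularity forces \<open>W \<subseteq> F \<otimes> C'\<close>, i.e. \<open>F C \<subseteq> C'\<close>.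
\<close>

section \<open>Dimensions of finite-dimensional subspaces\<close>

context vector_space
begin

lemma finite_dimensional_imp_subspace: "finite_dimensional scale V \<Longrightarrow> subspace V"
  by (auto simp: finite_dimensional_def)

lemma finite_dimensional_subset:
  assumes "finite_dimensional scale V" "subspace U" "U \<subseteq> V"
  shows "finite_dimensional scale U"
proof -
  obtain B where B: "finite B" "V = span B"
    using assms(1) by (auto simp: finite_dimensional_def)
  obtain b where b: "b \<subseteq> U" "independent b" "U \<subseteq> span b"
    by (rule basis_exists)
  have "b \<subseteq> span B"
    using b(1) assms(3) B(2) by blast
  then have "finite b"
    using independent_span_bound[OF B(1) b(2)] by blast
  moreover have "span b = U"
    by (rule span_subspace[OF b(1,3) assms(2)])
  ultimately show ?thesis
    by (auto simp: finite_dimensional_def)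
qed

lemma finite_dimensional_basis:
  assumes "finite_dimensional scale V"
  obtains B where "finite B" "independent B" "span B = V" "card B = dim V"
proof -
  obtain A where A: "finite A" "V = span A"
    using assms by (auto simp: finite_dimensional_def)
  obtain B where B: "B \<subseteq> V" "independent B" "V \<subseteq> span B" "card B = dim V"
    by (rule basis_exists)
  have "finite B"
    using independent_span_bound[OF A(1) B(2)] B(1) A(2) by auto
  moreover have "span B = V"
    by (rule span_subspace[OF B(1,3)]) (simp add: A(2))
  ultimately show thesis
    using B that by blast
qed

lemma finite_dimensional_sum:
  assumes "finite_dimensional scale U" "finite_dimensional scale V"
  shows "finite_dimensional scale (U + V)"
proof -
  obtain A B where "finite A" "U = span A" "finite B" "V = span B"
    using assms by (auto simp: finite_dimensional_def)
  then have "U + V = span (A \<union> B)"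
    by (auto simp: span_Un set_plus_def)
  then show ?thesis
    using \<open>finite A\<close> \<open>finite B\<close> by (auto simp: finite_dimensional_def)
qed

lemma finite_dimensional_singleton_0: "finite_dimensional scale {0}"
  unfolding finite_dimensional_def by (rule exI[of _ "{}"]) simp

lemma subspace_set_plus: "subspace U \<Longrightarrow> subspace V \<Longrightarrow> subspace (U + V)"
  using subspace_sums[of U V] by (simp add: set_plus_def Bex_def conj_commute conj_left_commute)

lemma set_plus_subset_subspace:
  assumes "subspace W" "U \<subseteq> W" "V \<subseteq> W"
  shows "U + V \<subseteq> W"
  using subspace_add[OF assms(1)] assms(2,3) by (blast elim: set_plus_elim)

lemma dim_mono_finite_dimensional:
  assumes "finite_dimensional scale V" "U \<subseteq> V"
  shows "dim U \<le> dim V"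
proof -
  obtain B where "finite B" "span B = V" "card B = dim V"
    using finite_dimensional_basis[OF assms(1)] by blast
  then show ?thesis
    using dim_le_card[of U B] assms(2) by auto
qed

lemma dim_eq_imp_eq:
  assumes "finite_dimensional scale V" "subspace U" "U \<subseteq> V" "dim V \<le> dim U"
  shows "U = V"
proof (rule ccontr)
  assume "U \<noteq> V"
  then obtain v where v: "v \<in> V" "v \<notin> U"
    using assms(3) by blast
  obtain b where b: "finite b" "independent b" "span b = U" "card b = dim U"
    using finite_dimensional_basis[OF finite_dimensional_subset[OF assms(1-3)]] by blast
  obtain B where B: "finite B" "span B = V" "card B = dim V"
    using finite_dimensional_basis[OF assms(1)] by blast
  have "independent (insert v b)"
    using v b by (intro independent_insertI) auto
  moreover have "insert v b \<subseteq> span B"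
    using v b B assms(3) span_superset[of b] by auto
  ultimately have "card (insert v b) \<le> card B"
    using independent_span_bound[OF B(1)] by blast
  moreover have "v \<notin> b"
    using v b span_base by auto
  ultimately show False
    using b B assms(4) by simp
qed

lemma dim_pos:
  assumes "finite_dimensional scale V" "V \<noteq> {0}"
  shows "dim V > 0"
proof (rule ccontr)
  assume "\<not> dim V > 0"
  moreover obtain B where B: "finite B" "span B = V" "card B = dim V"
    using finite_dimensional_basis[OF assms(1)] by blast
  ultimately have "B = {}"
    by simp
  with B(2) assms(2) show False
    using span_empty by metis
qed

lemma dim_singleton_0: "dim {0} = 0"
  using dim_span_eq_card_independent[OF independent_empty] by simp

text \<open>Grassmann's formula: a basis \<open>b\<close> of the intersection grows to a basis
  \<open>bA\<close> of \<open>A\<close>, and \<open>bA\<close> to a basis \<open>bS\<close> of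
  \<open>A + B\<close>. Then \<open>b\<close> together with the vectors of \<open>bS\<close> outside
  \<open>bA\<close> is a basis of \<open>B\<close>, and counting gives the formula.\<close>

lemma dim_sum_Int:
  assumes "finite_dimensional scale A" "finite_dimensional scale B"
  shows "dim (A + B) + dim (A \<inter> B) = dim A + dim B"
proof -
  have sub: "subspace A" "subspace B"
    using assms by (auto intro: finite_dimensional_imp_subspace)
  have zero: "0 \<in> A" "0 \<in> B"
    using sub subspace_0 by auto
  have "finite_dimensional scale (A \<inter> B)"
    by (rule finite_dimensional_subset[OF assms(1) subspace_inter[OF sub]]) blast
  from finite_dimensional_basis[OF this]
  obtain b where b: "finite b" "independent b" "span b = A \<inter> B" "card b = dim (A \<inter> B)"
    by blast
  have "b \<subseteq> A"
    using b(3) span_superset by blast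
  then obtain bA where bA: "b \<subseteq> bA" "bA \<subseteq> A" "independent bA" "A \<subseteq> span bA"
    using maximal_independent_subset_extend[OF _ b(2)] by blast
  have spA: "span bA = A"
    by (rule span_subspace[OF bA(2,4) sub(1)])
  obtain bS where bS: "bA \<subseteq> bS" "bS \<subseteq> A \<union> B" "independent bS" "A \<union> B \<subseteq> span bS"
    using maximal_independent_subset_extend[of bA "A \<union> B"] bA by blast
  have "A + B \<subseteq> span bS"
    using bS(4) by (intro set_plus_subset_subspace) auto
  moreover have "bS \<subseteq> A + B"
  proof
    fix x assume "x \<in> bS"
    then consider "x \<in> A" | "x \<in> B"
      using bS(2) by blast
    then show "x \<in> A + B"
      using set_plus_intro[of x A 0 B] set_plus_intro[of 0 A x B] zero by cases simp_all
  qed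
  ultimately have spS: "span bS = A + B"
    by (intro span_subspace subspace_set_plus sub)
  obtain T where T: "finite T" "A + B = span T"
    using finite_dimensional_sum[OF assms] by (auto simp: finite_dimensional_def)
  have fS: "finite bS"
    using independent_span_bound[OF T(1) bS(3)] span_superset[of bS] spS T(2) by auto
  have sum: "dim (A + B) = card bS"
    using dim_span_eq_card_independent[OF bS(3)] spS by simp
  have A: "dim A = card bA"
    using dim_span_eq_card_independent[OF bA(3)] spA by simp
  define bB where "bB = b \<union> (bS - bA)"
  \<comment> \<open>A vector of \<open>bS\<close> lying in \<open>A\<close> is in the span of
    \<open>bA\<close>, so by independence it belongs to \<open>bA\<close> already; the new vectors
    therefore come from \<open>B\<close>.\<close>
  have new_in_B: "bS - bA \<subseteq> B"
  proof -
    have "z \<in> B" if z: "z \<in> bS" "z \<notin> bA" for z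
    proof (rule ccontr)
      assume "z \<notin> B"
      then have "z \<in> span bA"
        using bS(2) z spA by auto
      moreover have "bA \<subseteq> bS - {z}"
        using bS(1) z by auto
      ultimately have "z \<in> span (bS - {z})"
        using span_mono by blast
      then show False
        using bS(3) z dependent_def by blast
    qed
    then show ?thesis by auto
  qed
  have "B \<subseteq> span bB"
  proof
    fix x assume x: "x \<in> B"
    have "x \<in> span (bA \<union> (bS - bA))"
      using x bS(1,4) by (auto simp: Un_absorb1)
    then obtain a y where ay: "x = a + y" "a \<in> span bA" "y \<in> span (bS - bA)"
      unfolding span_Un by blast
    have "y \<in> B"
      using ay(3) span_minimal[OF new_in_B sub(2)] by blast
    then have "a \<in> span b"
      using ay(1,2) x b(3) spA subspace_diff[OF sub(2), of x y] by auto
    then show "x \<in> span bB"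
      using ay span_mono[of b bB] span_mono[of "bS - bA" bB] span_add[of a bB y]
      unfolding bB_def by blast
  qed
  moreover have "bB \<subseteq> B"
    using new_in_B b(3) span_superset[of b] by (auto simp: bB_def)
  ultimately have "span bB = B"
    by (intro span_subspace sub)
  moreover have "independent bB"
    by (rule independent_mono[OF bS(3)]) (use bA(1) bS(1) in \<open>auto simp: bB_def\<close>)
  ultimately have "dim B = card bB"
    using dim_span_eq_card_independent by metis
  also have "\<dots> = card b + card (bS - bA)"
    unfolding bB_def using b(1) fS bA(1) by (intro card_Un_disjoint) auto
  also have "card (bS - bA) = card bS - card bA"
    using fS bS(1) by (intro card_Diff_subset finite_subset[OF bS(1)])
  finally show ?thesis
    using sum A b(4) card_mono[OF fS bS(1)] by simp
qed

end

section \<open>Rank, nullity and images of finite-dimensional subspaces\<close>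

context vector_space_pair
begin

text \<open>A basis \<open>bK\<close> of the kernel is extended to a basis of \<open>V\<close>. The
  map is injective on the span of the added vectors \<open>R\<close>, and their images form a basis
  of the image.\<close>

lemma dim_image_plus_dim_kernel:
  assumes "Vector_Spaces.linear s1 s2 f" "finite_dimensional s1 V"
  shows "vs1.dim V = vs2.dim (f ` V) + vs1.dim {v\<in>V. f v = 0}"
proof -
  interpret f: module_hom s1 s2 f using assms(1) by (simp only: module_hom_iff_linear)
  have sub: "vs1.subspace V"
    using assms(2) by (rule vs1.finite_dimensional_imp_subspace)
  define K where "K = {v\<in>V. f v = 0}"
  have "K = V \<inter> {v. f v = 0}"
    by (auto simp: K_def)
  then have subK: "vs1.subspace K"
    using vs1.subspace_inter[OF sub f.subspace_kernel] by simp
  have "finite_dimensional s1 K"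
    by (rule vs1.finite_dimensional_subset[OF assms(2) subK]) (auto simp: K_def)
  from vs1.finite_dimensional_basis[OF this]
  obtain bK where bK: "finite bK" "vs1.independent bK" "vs1.span bK = K"
      "card bK = vs1.dim K"
    by blast
  have "bK \<subseteq> V"
    using bK(3) vs1.span_superset[of bK] by (auto simp: K_def)
  then obtain B where B: "bK \<subseteq> B" "B \<subseteq> V" "vs1.independent B" "V \<subseteq> vs1.span B"
    using vs1.maximal_independent_subset_extend[OF _ bK(2)] by blast
  have spB: "vs1.span B = V"
    by (rule vs1.span_subspace[OF B(2,4) sub])
  obtain T where T: "finite T" "V = vs1.span T"
    using assms(2) by (auto simp: finite_dimensional_def)
  have fB: "finite B"
    using vs1.independent_span_bound[OF T(1) B(3)] B(2) T(2) by auto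
  define R where "R = B - bK"
  have indR: "vs1.independent R"
    by (rule vs1.independent_mono[OF B(3)]) (auto simp: R_def)
  have "x = 0" if x: "x \<in> vs1.span R" "f x = 0" for x
  proof -
    have "R \<subseteq> B" by (auto simp: R_def)
    have "x \<in> V"
      using x(1) spB vs1.span_mono[OF \<open>R \<subseteq> B\<close>] by auto
    then have xK: "x \<in> vs1.span bK"
      using x(2) bK(3) by (auto simp: K_def)
    \<comment> \<open>\<open>x\<close> lies in the spans of two disjoint parts of the basis
      \<open>B\<close>, so no basis vector can occur in its expansion.\<close>
    have "vs1.representation B x b = 0" for b
    proof (rule ccontr)
      assume nz: "vs1.representation B x b \<noteq> 0"
      have "b \<in> R"
        using nz vs1.representation_extend[OF B(3) x(1) \<open>R \<subseteq> B\<close>]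
          vs1.representation_ne_zero[of R x b] by auto
      moreover have "b \<in> bK"
        using nz vs1.representation_extend[OF B(3) xK B(1)]
          vs1.representation_ne_zero[of bK x b] by auto
      ultimately show False by (simp add: R_def)
    qed
    then show "x = 0"
      using vs1.sum_nonzero_representation_eq[OF B(3), of x] \<open>x \<in> V\<close> spB by simp
  qed
  then have inj: "inj_on f (vs1.span R)"
    using f.inj_on_iff_eq_0[of "vs1.span R"] vs1.subspace_span by blast
  have ind: "vs2.independent (f ` R)"
    by (rule f.independent_injective_image[OF indR inj])
  have "f ` V = vs2.span (f ` B)"
    by (simp add: f.span_image spB)
  also have "\<dots> = vs2.span (f ` R)"
  proof (rule antisym)
    have "f b \<in> vs2.span (f ` R)" if "b \<in> B" for b
    proof (cases "b \<in> bK")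
      case True
      then have "f b = 0"
        using bK(3) vs1.span_base[of b bK] by (auto simp: K_def)
      then show ?thesis by (simp add: vs2.span_zero)
    next
      case False
      then show ?thesis
        using that by (intro vs2.span_base) (auto simp: R_def)
    qed
    then show "vs2.span (f ` B) \<subseteq> vs2.span (f ` R)"
      by (intro vs2.span_minimal) auto
  qed (auto simp: R_def intro!: vs2.span_mono)
  finally have "vs2.dim (f ` V) = card (f ` R)"
    using vs2.dim_span_eq_card_independent[OF ind] by simp
  also have "\<dots> = card R"
    by (intro card_image inj_on_subset[OF inj] vs1.span_superset)
  also have "\<dots> = card B - card bK"
    unfolding R_def by (intro card_Diff_subset B bK)
  finally show ?thesis
    using card_mono[OF fB B(1)] bK(4) vs1.dim_span_eq_card_independent[OF B(3)] spB
    by (simp add: K_def)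
qed

lemma finite_dimensional_image:
  assumes "Vector_Spaces.linear s1 s2 f" "finite_dimensional s1 V"
  shows "finite_dimensional s2 (f ` V)"
proof -
  interpret f: module_hom s1 s2 f using assms(1) by (simp only: module_hom_iff_linear)
  obtain B where "finite B" "V = vs1.span B"
    using assms(2) by (auto simp: finite_dimensional_def)
  then show ?thesis
    unfolding finite_dimensional_def by (intro exI[of _ "f ` B"]) (simp add: f.span_image)
qed

lemma dim_image_inj_on:
  assumes "Vector_Spaces.linear s1 s2 f" "finite_dimensional s1 V" "\<And>v. v \<in> V \<Longrightarrow> f v = 0 \<Longrightarrow> v = 0"
  shows "vs2.dim (f ` V) = vs1.dim V"
proof -
  interpret f: module_hom s1 s2 f using assms(1) by (simp only: module_hom_iff_linear)
  have "0 \<in> V"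
    using vs1.finite_dimensional_imp_subspace[OF assms(2)] vs1.subspace_0 by blast
  then have "{v\<in>V. f v = 0} = {0}"
    using assms(3) f.zero by blast
  also have "\<dots> = vs1.span {}"
    by (rule vs1.span_empty[symmetric])
  finally have kernel: "{v\<in>V. f v = 0} = vs1.span {}" .
  have "vs1.dim {v\<in>V. f v = 0} = card ({} :: 'b set)"
    unfolding kernel by (rule vs1.dim_span_eq_card_independent[OF vs1.independent_empty])
  then show ?thesis
    using dim_image_plus_dim_kernel[OF assms(1,2)] by simp
qed

end

section \<open>Stable subspaces of powers of a vector space\<close>

definition scale_fun :: "('k \<Rightarrow> 'v \<Rightarrow> 'v) \<Rightarrow> 'k \<Rightarrow> ('i \<Rightarrow> 'v) \<Rightarrow> 'i \<Rightarrow> 'v" where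
  "scale_fun s r m = (\<lambda>i. s r (m i))"

text \<open>With \<open>I\<close> a basis of \<open>F\<close>, these are the coordinate vectors of
  \<open>F \<otimes> C\<close>. As functions are defined on the whole index type, the value zero is
  prescribed outside \<open>I\<close>; this keeps the space finite-dimensional for finite
  \<open>I\<close>.\<close>

definition tuples :: "'i set \<Rightarrow> 'v::zero set \<Rightarrow> ('i \<Rightarrow> 'v) set" where
  "tuples I C = {m. (\<forall>i\<in>I. m i \<in> C) \<and> (\<forall>i. i \<notin> I \<longrightarrow> m i = 0)}"

definition stable :: "('k::field \<Rightarrow> 'v::ab_group_add \<Rightarrow> 'v) \<Rightarrow> ('v \<Rightarrow> 'v) set \<Rightarrow> 'v set \<Rightarrow> bool" where
  "stable s P D \<longleftrightarrow> module.subspace s D \<and> (\<forall>p\<in>P. \<forall>x\<in>D. p x \<in> D)"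

lemma vector_space_scale_fun: "vector_space s \<Longrightarrow> vector_space (scale_fun s)"
  by (simp add: vector_space_def scale_fun_def fun_eq_iff)

lemma tuples_Int: "tuples I (C \<inter> D) = tuples I C \<inter> tuples I D"
  by (auto simp: tuples_def)

context vector_space
begin

interpretation Fn: vector_space "scale_fun scale :: 'a \<Rightarrow> ('i \<Rightarrow> 'b) \<Rightarrow> _"
  by (rule vector_space_scale_fun) unfold_locales

interpretation ev: vector_space_pair "scale_fun scale :: 'a \<Rightarrow> ('i \<Rightarrow> 'b) \<Rightarrow> _" scale
  by unfold_locales

interpretation en: vector_space_pair "scale_fun scale :: 'a \<Rightarrow> ('i \<Rightarrow> 'b) \<Rightarrow> _" "scale_fun scale :: 'a \<Rightarrow> ('i \<Rightarrow> 'b) \<Rightarrow> _"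
  by unfold_locales

lemma linear_eval: "Vector_Spaces.linear (scale_fun scale) scale (\<lambda>m. m i)"
  unfolding Vector_Spaces.linear_iff using Fn.vector_space_axioms vector_space_axioms
  by (simp add: scale_fun_def)

lemma linear_unit: "Vector_Spaces.linear scale (scale_fun scale) (\<lambda>x j. if j = i then x else 0)"
  unfolding Vector_Spaces.linear_iff using Fn.vector_space_axioms vector_space_axioms
  by (simp add: scale_fun_def fun_eq_iff)

lemma subspace_tuples: "subspace C \<Longrightarrow> module.subspace (scale_fun scale) (tuples I C)"
  by (rule Fn.subspaceI) (auto simp: tuples_def scale_fun_def subspace_0 subspace_add subspace_scale)

lemma finite_dimensional_tuples:
  fixes I :: "'i set"
  assumes "finite I" "finite_dimensional scale C"
  shows "finite_dimensional (scale_fun scale) (tuples I C)"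
proof -
  define u :: "'i \<Rightarrow> 'b \<Rightarrow> 'i \<Rightarrow> 'b" where "u i x = (\<lambda>j. if j = i then x else 0)" for i x
  obtain B where B: "finite B" "C = span B"
    using assms(2) unfolding finite_dimensional_def by blast
  define U where "U = (\<Union>i\<in>I. u i ` B)"
  have "tuples I C \<subseteq> Fn.span U"
  proof
    fix m assume m: "m \<in> tuples I C"
    have "u i (m i) \<in> Fn.span U" if "i \<in> I" for i
    proof -
      interpret u: module_hom scale "scale_fun scale" "u i"
        unfolding module_hom_iff_linear u_def by (rule linear_unit)
      have "m i \<in> span B"
        using m that B(2) by (simp add: tuples_def)
      then have "u i (m i) \<in> u i ` span B"
        by (rule imageI)
      then have "u i (m i) \<in> Fn.span (u i ` B)"
        unfolding u.span_image .
      moreover have "u i ` B \<subseteq> U"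
        using that by (auto simp: U_def)
      ultimately show ?thesis
        using Fn.span_mono by blast
    qed
    then have "(\<Sum>i\<in>I. u i (m i)) \<in> Fn.span U"
      by (rule Fn.span_sum)
    moreover have "(\<Sum>i\<in>I. u i (m i)) j = m j" for j
    proof -
      have "(\<Sum>i\<in>I. u i (m i)) j = (\<Sum>i\<in>I. u i (m i) j)"
        using assms(1) by (induction I rule: finite_induct) simp_all
      also have "\<dots> = m j"
        using m assms(1) by (simp add: u_def tuples_def)
      finally show ?thesis .
    qed
    then have "(\<Sum>i\<in>I. u i (m i)) = m"
      by (rule ext)
    ultimately show "m \<in> Fn.span U"
      by simp
  qed
  moreover have "finite_dimensional (scale_fun scale) (Fn.span U)"
    unfolding finite_dimensional_def
    by (rule exI[of _ U]) (simp add: U_def assms(1) B(1))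
  moreover have "subspace C"
    using assms(2) by (rule finite_dimensional_imp_subspace)
  ultimately show ?thesis
    using Fn.finite_dimensional_subset subspace_tuples by blast
qed

lemma tuples_empty: "tuples {} C = {0}"
  by (auto simp: tuples_def fun_eq_iff)

lemma dim_tuples:
  fixes I :: "'i set"
  assumes "finite I" "finite_dimensional scale C"
  shows "vector_space.dim (scale_fun scale) (tuples I C) = card I * dim C"
  using assms(1)
proof (induction I rule: finite_induct)
  case empty
  then show ?case by (simp add: tuples_empty Fn.dim_singleton_0)
next
  case (insert i I)
  have "0 \<in> C"
    using finite_dimensional_imp_subspace[OF assms(2)] subspace_0 by blast
  have "(\<lambda>m. m i) ` tuples (insert i I) C = C"
  proof
    show "C \<subseteq> (\<lambda>m. m i) ` tuples (insert i I) C"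
    proof
      fix c assume "c \<in> C"
      then show "c \<in> (\<lambda>m. m i) ` tuples (insert i I) C"
        using \<open>0 \<in> C\<close> by (intro image_eqI[of _ _ "\<lambda>j. if j = i then c else 0"]) (auto simp: tuples_def)
    qed
  qed (auto simp: tuples_def)
  moreover have "{m \<in> tuples (insert i I) C. m i = 0} = tuples I C"
    using \<open>0 \<in> C\<close> insert.hyps by (auto simp: tuples_def)
  ultimately show ?case
    using ev.dim_image_plus_dim_kernel[OF linear_eval finite_dimensional_tuples[OF _ assms(2)], of "insert i I" i]
      insert by simp
qed

text \<open>Evaluation at a new index splits \<open>W\<close> into its image, a stable subspace of
  the base space, and its kernel, a stable subspace of a smaller power. The dimension of
  \<open>W\<close> adds up exactly, that of its intersection with the power of \<open>E\<close> at
  most, so the bounds add. Thus the power of a maximizer beats all stable subspaces, including those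
  that are not powers.\<close>

lemma stable_tuples_bound:
  fixes I :: "'i set" and W :: "('i \<Rightarrow> 'b) set"
  assumes "finite I" and P: "\<And>p. p \<in> P \<Longrightarrow> p 0 = 0"
    and bound: "\<And>D. stable scale P D \<Longrightarrow> finite_dimensional scale D \<Longrightarrow>
      int N * int (dim (E \<inter> D)) - int k * int (dim D) \<le> \<mu>"
    and E: "subspace E"
    and "stable (scale_fun scale) ((\<circ>) ` P) W" "finite_dimensional (scale_fun scale) W"
      "W \<subseteq> tuples I UNIV"
  shows "int N * int (vector_space.dim (scale_fun scale) (tuples I E \<inter> W))
     - int k * int (vector_space.dim (scale_fun scale) W) \<le> int (card I) * \<mu>"
  using assms(1,5-)
proof (induction I arbitrary: W rule: finite_induct)
  case empty
  have "0 \<in> W"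
    using empty(1) Fn.subspace_0 unfolding stable_def by blast
  moreover have "0 \<in> tuples {} E"
    by (simp add: tuples_empty)
  ultimately have "W = {0}" "tuples {} E \<inter> W = {0}"
    using empty(3) by (auto simp: tuples_empty)
  then show ?case
    by (simp add: Fn.dim_singleton_0)
next
  case (insert i I)
  let ?e = "\<lambda>m::'i \<Rightarrow> 'b. m i"
  interpret e: module_hom "scale_fun scale" scale ?e
    unfolding module_hom_iff_linear by (rule linear_eval)
  define Z where "Z = tuples (insert i I) E \<inter> W"
  define W0 where "W0 = {m\<in>W. m i = 0}"
  have subW: "Fn.subspace W"
    using insert.prems(1) by (simp add: stable_def)
  have op: "p \<circ> m \<in> W" if "p \<in> P" "m \<in> W" for p m
    using insert.prems(1) that unfolding stable_def by blast
  have "W0 = W \<inter> {m. m i = 0}"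
    by (auto simp: W0_def)
  then have "Fn.subspace W0"
    using Fn.subspace_inter[OF subW e.subspace_kernel] by simp
  then have fdW0: "finite_dimensional (scale_fun scale) W0"
    by (rule Fn.finite_dimensional_subset[OF insert.prems(2)]) (simp add: W0_def)
  have fdZ: "finite_dimensional (scale_fun scale) Z"
    unfolding Z_def by (rule Fn.finite_dimensional_subset[OF insert.prems(2)
        Fn.subspace_inter[OF subspace_tuples[OF E] subW]]) simp
  have fdW1: "finite_dimensional scale (?e ` W)"
    by (rule ev.finite_dimensional_image[OF linear_eval insert.prems(2)])
  have "stable scale P (?e ` W)"
    unfolding stable_def
  proof (intro conjI ballI)
    show "subspace (?e ` W)"
      by (rule e.subspace_image[OF subW])
    fix p x assume p: "p \<in> P" and "x \<in> ?e ` W"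
    then obtain m where "m \<in> W" "x = m i"
      by blast
    then show "p x \<in> ?e ` W"
      using op[OF p] by (intro image_eqI[of _ _ "p \<circ> m"]) simp_all
  qed
  then have 1: "int N * int (dim (E \<inter> ?e ` W)) - int k * int (dim (?e ` W)) \<le> \<mu>"
    using bound fdW1 by blast
  have "stable (scale_fun scale) ((\<circ>) ` P) W0"
    unfolding stable_def using \<open>Fn.subspace W0\<close> op P by (auto simp: W0_def)
  moreover have "W0 \<subseteq> tuples I UNIV"
    using insert.prems(3) by (auto simp: W0_def tuples_def)
  ultimately have 2: "int N * int (Fn.dim (tuples I E \<inter> W0)) - int k * int (Fn.dim W0)
      \<le> int (card I) * \<mu>"
    using insert.IH fdW0 by blast
  have W: "Fn.dim W = dim (?e ` W) + Fn.dim W0"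
    unfolding W0_def by (rule ev.dim_image_plus_dim_kernel[OF linear_eval insert.prems(2)])
  have "Fn.dim Z = dim (?e ` Z) + Fn.dim {m\<in>Z. m i = 0}"
    by (rule ev.dim_image_plus_dim_kernel[OF linear_eval fdZ])
  moreover have "{m\<in>Z. m i = 0} = tuples I E \<inter> W0"
    using subspace_0[OF E] insert.hyps by (auto simp: Z_def W0_def tuples_def)
  moreover have "finite_dimensional scale (E \<inter> ?e ` W)"
    by (rule finite_dimensional_subset[OF fdW1 subspace_inter[OF E e.subspace_image[OF subW]]]) simp
  \<comment> \<open>Only an inequality: an element of \<open>E\<close> that is a coordinate of some
    tuple in \<open>W\<close> need not be a coordinate of a tuple in \<open>W\<close> with all
    entries in \<open>E\<close>.\<close>
  then have "dim (?e ` Z) \<le> dim (E \<inter> ?e ` W)"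
    by (rule dim_mono_finite_dimensional) (auto simp: Z_def tuples_def)
  ultimately have "int (Fn.dim Z) \<le> int (dim (E \<inter> ?e ` W)) + int (Fn.dim (tuples I E \<inter> W0))"
    by simp
  then have "int N * int (Fn.dim Z)
      \<le> int N * (int (dim (E \<inter> ?e ` W)) + int (Fn.dim (tuples I E \<inter> W0)))"
    by (rule mult_left_mono) simp
  then show ?case
    using 1 2 W insert.hyps unfolding Z_def by (simp add: algebra_simps)
qed

text \<open>As \<open>g\<close> is injective, the dimension gained from \<open>CI'\<close> to
  \<open>W + CI'\<close> equals the dimension lost from \<open>CI\<close> to \<open>V\<close>.
  Maximality bounds \<open>N\<close> times the gain inside \<open>EI'\<close> above by
  \<open>k'\<close> times this number, and \<open>N\<close> times the loss inside \<open>EI\<close>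
  below by \<open>k\<close> times it, while supermodularity makes the gain at least the loss. As
  \<open>k' < k\<close>, the number is zero and \<open>V\<close> is all of
  \<open>CI\<close>.\<close>

lemma maximizer_transport:
  fixes I :: "'i set" and g :: "('i \<Rightarrow> 'b) \<Rightarrow> 'i \<Rightarrow> 'b"
  assumes "finite I" and P: "\<And>p. p \<in> P \<Longrightarrow> Vector_Spaces.linear scale scale p"
    and E: "subspace E" and E': "subspace E'"
    and C: "stable scale P C" "finite_dimensional scale C"
    and C': "stable scale P C'" "finite_dimensional scale C'"
    and max: "\<And>D. stable scale P D \<Longrightarrow> finite_dimensional scale D \<Longrightarrow>
      int N * int (dim (E \<inter> D)) - int k * int (dim D)
      \<le> int N * int (dim (E \<inter> C)) - int k * int (dim C)"
    and max': "\<And>D. stable scale P D \<Longrightarrow> finite_dimensional scale D \<Longrightarrow>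
      int N * int (dim (E' \<inter> D)) - int k' * int (dim D)
      \<le> int N * int (dim (E' \<inter> C')) - int k' * int (dim C')"
    and "k' < k"
    and g: "Vector_Spaces.linear (scale_fun scale) (scale_fun scale) g"
    and g_into: "g ` tuples I C \<subseteq> tuples I UNIV"
    and g_inj: "\<And>m. m \<in> tuples I C \<Longrightarrow> g m = 0 \<Longrightarrow> m = 0"
    and g_E: "g ` tuples I E \<subseteq> tuples I E'"
    and stable_image: "stable (scale_fun scale) ((\<circ>) ` P) (g ` tuples I C)"
    and stable_preimage: "stable (scale_fun scale) ((\<circ>) ` P) {m \<in> tuples I C. g m \<in> tuples I C'}"
  shows "g ` tuples I C \<subseteq> tuples I C'"
proof -
  interpret g: module_hom "scale_fun scale" "scale_fun scale" g
    unfolding module_hom_iff_linear by (rule g)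
  let ?d = "vector_space.dim (scale_fun scale) :: ('i \<Rightarrow> 'b) set \<Rightarrow> nat"
  let ?fd = "finite_dimensional (scale_fun scale) :: ('i \<Rightarrow> 'b) set \<Rightarrow> bool"
  define CI where "CI = tuples I C"
  define CI' where "CI' = tuples I C'"
  define EI where "EI = tuples I E"
  define EI' where "EI' = tuples I E'"
  define W where "W = g ` CI"
  define V where "V = {m \<in> CI. g m \<in> CI'}"
  have P0: "p 0 = 0" if "p \<in> P" for p
    using P[OF that] unfolding module_hom_iff_linear[symmetric] by (rule module_hom.zero)
  have P_add: "p (x + y) = p x + p y" if "p \<in> P" for p x y
    using P[OF that] unfolding Vector_Spaces.linear_iff by blast
  have fd: "?fd CI" "?fd CI'"
    unfolding CI_def CI'_def using finite_dimensional_tuples assms(1) C(2) C'(2) by blast+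
  have fdW: "?fd W"
    unfolding W_def by (rule en.finite_dimensional_image[OF g fd(1)])
  have sub: "Fn.subspace CI" "Fn.subspace CI'" "Fn.subspace W"
    using fd fdW Fn.finite_dimensional_imp_subspace by blast+
  have subE: "Fn.subspace EI" "Fn.subspace EI'"
    unfolding EI_def EI'_def by (intro subspace_tuples E E')+
  have fdX: "?fd (W + CI')"
    by (rule Fn.finite_dimensional_sum[OF fdW fd(2)])
  have subV: "Fn.subspace V"
    using stable_preimage unfolding V_def CI_def CI'_def stable_def by blast
  have "V \<subseteq> CI"
    by (auto simp: V_def)
  have fdV: "?fd V"
    by (rule Fn.finite_dimensional_subset[OF fd(1) subV \<open>V \<subseteq> CI\<close>])
  have stV: "stable (scale_fun scale) ((\<circ>) ` P) V"
    using stable_preimage by (simp add: V_def CI_def CI'_def)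
  have stX: "stable (scale_fun scale) ((\<circ>) ` P) (W + CI')"
    unfolding stable_def
  proof (intro conjI ballI)
    show "Fn.subspace (W + CI')"
      by (rule Fn.finite_dimensional_imp_subspace[OF fdX])
    fix q :: "('i \<Rightarrow> 'b) \<Rightarrow> 'i \<Rightarrow> 'b" and x
    assume "q \<in> (\<circ>) ` P" "x \<in> W + CI'"
    then obtain p where p: "p \<in> P" "q = (\<circ>) p" by blast
    obtain w c where x: "x = w + c" "w \<in> W" "c \<in> CI'"
      using \<open>x \<in> W + CI'\<close> by (rule set_plus_elim)
    have "p \<circ> w \<in> W"
      using stable_image p x(2) unfolding stable_def W_def CI_def by blast
    moreover have "p \<circ> c \<in> CI'"
      using C'(1) p x(3) P0 unfolding stable_def CI'_def tuples_def by auto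
    moreover have "q x = (p \<circ> w) + (p \<circ> c)"
      by (simp add: p x P_add fun_eq_iff)
    ultimately show "q x \<in> W + CI'"
      using set_plus_intro by metis
  qed
  have "CI' \<subseteq> tuples I UNIV" "CI \<subseteq> tuples I UNIV"
    by (auto simp: CI_def CI'_def tuples_def)
  have X_sub: "W + CI' \<subseteq> tuples I UNIV"
  proof
    fix x assume "x \<in> W + CI'"
    then obtain w c where "x = w + c" "w \<in> W" "c \<in> CI'"
      by (rule set_plus_elim)
    then show "x \<in> tuples I UNIV"
      using g_into unfolding W_def CI_def CI'_def tuples_def by auto
  qed
  \<comment> \<open>Maximality of \<open>C'\<close> and \<open>C\<close> among stable subspaces of
    the base space is lifted to the powers; \<open>W + CI'\<close> and \<open>V\<close> need not be
    powers themselves.\<close>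
  have boundX: "int N * int (?d (tuples I E' \<inter> (W + CI'))) - int k' * int (?d (W + CI'))
      \<le> int (card I) * (int N * int (dim (E' \<inter> C')) - int k' * int (dim C'))"
    by (intro stable_tuples_bound[where P = P] assms(1) E' stX fdX X_sub) (fact P0 max')+
  have boundV: "int N * int (?d (tuples I E \<inter> V)) - int k * int (?d V)
      \<le> int (card I) * (int N * int (dim (E \<inter> C)) - int k * int (dim C))"
    by (intro stable_tuples_bound[where P = P] assms(1) E stV fdV
        subset_trans[OF \<open>V \<subseteq> CI\<close> \<open>CI \<subseteq> tuples I UNIV\<close>]) (fact P0 max)+
  have dimI: "?d CI = card I * dim C" "?d CI' = card I * dim C'"
    unfolding CI_def CI'_def using dim_tuples assms(1) C(2) C'(2) by blast+
  have fdEC: "finite_dimensional scale (E \<inter> C)" "finite_dimensional scale (E' \<inter> C')"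
    using finite_dimensional_subset[OF C(2) subspace_inter[OF E finite_dimensional_imp_subspace[OF C(2)]]]
      finite_dimensional_subset[OF C'(2) subspace_inter[OF E' finite_dimensional_imp_subspace[OF C'(2)]]]
    by simp_all
  have dimE: "?d (EI \<inter> CI) = card I * dim (E \<inter> C)" "?d (EI' \<inter> CI') = card I * dim (E' \<inter> C')"
    unfolding EI_def CI_def EI'_def CI'_def tuples_Int[symmetric]
    using dim_tuples assms(1) fdEC by blast+
  have X: "int N * int (?d (EI' \<inter> (W + CI'))) - int k' * int (?d (W + CI'))
      \<le> int N * int (?d (EI' \<inter> CI')) - int k' * int (?d CI')"
    using boundX unfolding EI'_def[symmetric] dimI dimE by (simp add: algebra_simps)
  have V: "int N * int (?d (EI \<inter> V)) - int k * int (?d V)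
      \<le> int N * int (?d (EI \<inter> CI)) - int k * int (?d CI)"
    using boundV unfolding EI_def[symmetric] dimI dimE by (simp add: algebra_simps)
  have gV: "g ` V = W \<inter> CI'"
    by (auto simp: V_def W_def)
  have inj: "?d (g ` U) = ?d U" if "?fd U" "U \<subseteq> CI" for U
    by (rule en.dim_image_inj_on[OF g that(1)]) (use that g_inj CI_def in blast)
  \<comment> \<open>Gain and loss agree: both are the dimension of \<open>W\<close> modulo
    \<open>W \<inter> CI'\<close>, which is the image of \<open>V\<close>.\<close>
  have sumX: "?d (W + CI') + ?d V = ?d CI + ?d CI'"
    using Fn.dim_sum_Int[OF fdW fd(2)] inj[OF fdV \<open>V \<subseteq> CI\<close>] inj[OF fd(1)]
    by (simp add: gV) (simp add: W_def)
  have fd_Int: "?fd (EI' \<inter> U)" if "?fd U" for U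
    by (rule Fn.finite_dimensional_subset[OF that
          Fn.subspace_inter[OF subE(2) Fn.finite_dimensional_imp_subspace[OF that]]]) simp
  have fd_IntE: "?fd (EI \<inter> U)" if "?fd U" for U
    by (rule Fn.finite_dimensional_subset[OF that
          Fn.subspace_inter[OF subE(1) Fn.finite_dimensional_imp_subspace[OF that]]]) simp
  \<comment> \<open>\<open>D \<mapsto> dim (E' \<inter> D)\<close> is supermodular.\<close>
  have "(EI' \<inter> W) + (EI' \<inter> CI') \<subseteq> EI' \<inter> (W + CI')"
    using Fn.subspace_add[OF subE(2)] by (auto elim!: set_plus_elim)
  then have "?d ((EI' \<inter> W) + (EI' \<inter> CI')) \<le> ?d (EI' \<inter> (W + CI'))"
    by (rule Fn.dim_mono_finite_dimensional[OF fd_Int[OF fdX]])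
  moreover have "(EI' \<inter> W) \<inter> (EI' \<inter> CI') = EI' \<inter> g ` V"
    by (auto simp: gV)
  ultimately have super: "?d (EI' \<inter> W) + ?d (EI' \<inter> CI') \<le> ?d (EI' \<inter> (W + CI')) + ?d (EI' \<inter> g ` V)"
    using Fn.dim_sum_Int[OF fd_Int[OF fdW] fd_Int[OF fd(2)]] by simp
  \<comment> \<open>Inside \<open>EI' \<inter> W\<close>, the image \<open>G\<close> of the tuples
    over \<open>E\<close> and the part of the image of \<open>V\<close> over \<open>E'\<close> meet
    exactly in the image of \<open>EI \<inter> V\<close>. This is where \<open>g_E\<close>
    enters.\<close>
  define G where "G = g ` (EI \<inter> CI)"
  have fdG: "?fd G"
    unfolding G_def by (rule en.finite_dimensional_image[OF g fd_IntE[OF fd(1)]])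
  have fdgV: "?fd (g ` V)"
    by (rule en.finite_dimensional_image[OF g fdV])
  have "G \<subseteq> EI' \<inter> W"
    using g_E by (auto simp: G_def W_def EI_def EI'_def)
  moreover have "EI' \<inter> g ` V \<subseteq> EI' \<inter> W"
    by (auto simp: gV)
  ultimately have "G + (EI' \<inter> g ` V) \<subseteq> EI' \<inter> W"
    by (rule Fn.set_plus_subset_subspace[OF Fn.subspace_inter[OF subE(2) sub(3)]])
  then have "?d (G + (EI' \<inter> g ` V)) \<le> ?d (EI' \<inter> W)"
    by (rule Fn.dim_mono_finite_dimensional[OF fd_Int[OF fdW]])
  moreover have "G \<inter> (EI' \<inter> g ` V) = g ` (EI \<inter> V)"
    using g_E by (auto simp: gV G_def V_def W_def EI_def EI'_def)
  moreover have "?d (g ` (EI \<inter> V)) = ?d (EI \<inter> V)" "?d G = ?d (EI \<inter> CI)"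
    unfolding G_def using inj[OF fd_IntE] fdV fd(1) \<open>V \<subseteq> CI\<close> by blast+
  ultimately have "?d (EI \<inter> CI) + ?d (EI' \<inter> g ` V) \<le> ?d (EI' \<inter> W) + ?d (EI \<inter> V)"
    using Fn.dim_sum_Int[OF fdG fd_Int[OF fdgV]] by simp
  with super have "int (?d (EI \<inter> CI)) - int (?d (EI \<inter> V))
      \<le> int (?d (EI' \<inter> (W + CI'))) - int (?d (EI' \<inter> CI'))"
    by linarith
  then have gain: "int N * (int (?d (EI \<inter> CI)) - int (?d (EI \<inter> V)))
      \<le> int N * (int (?d (EI' \<inter> (W + CI'))) - int (?d (EI' \<inter> CI')))"
    by (rule mult_left_mono) simp
  have "int k * (int (?d CI) - int (?d V)) \<le> int N * (int (?d (EI \<inter> CI)) - int (?d (EI \<inter> V)))"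
    using V by (simp add: algebra_simps)
  also note gain
  also have "int N * (int (?d (EI' \<inter> (W + CI'))) - int (?d (EI' \<inter> CI')))
      \<le> int k' * (int (?d (W + CI')) - int (?d CI'))"
    using X by (simp add: algebra_simps)
  also have "int (?d (W + CI')) - int (?d CI') = int (?d CI) - int (?d V)"
    using sumX by linarith
  finally have "int k * (int (?d CI) - int (?d V)) \<le> int k' * (int (?d CI) - int (?d V))" .
  then have "(int k - int k') * (int (?d CI) - int (?d V)) \<le> 0"
    by (simp add: algebra_simps)
  then have "?d CI \<le> ?d V"
    using \<open>k' < k\<close> by (simp add: mult_le_0_iff)
  then have "V = CI"
    by (rule Fn.dim_eq_imp_eq[OF fd(1) subV \<open>V \<subseteq> CI\<close>])
  then show ?thesis
    by (auto simp: V_def CI_def CI'_def)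
qed

end

section \<open>Sweedler notation\<close>

lemma lookup_free_scale [simp]: "Poly_Mapping.lookup (free_scale c f) x = c * Poly_Mapping.lookup f x"
  by (auto simp: free_scale_def Poly_Mapping.map.rep_eq when_def)

lemma vector_space_free_scale: "vector_space free_scale"
  by (simp add: vector_space_def poly_mapping_eq_iff fun_eq_iff lookup_add algebra_simps)

lemma vector_space_field: "vector_space ((*) :: 'k::field \<Rightarrow> 'k \<Rightarrow> 'k)"
  by (simp add: vector_space_def algebra_simps)

section \<open>Linear and bilinear maps as predicates, and linear extension\<close>

lemma linearI:
  assumes "vector_space s1" "vector_space s2"
    "\<And>x y. f (x + y) = f x + f y" "\<And>r x. f (s1 r x) = s2 r (f x)"
  shows "Vector_Spaces.linear s1 s2 f"
  using assms by (simp add: Vector_Spaces.linear_iff)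

lemma linearD:
  assumes "Vector_Spaces.linear s1 s2 f"
  shows linear_map_add: "f (x + y) = f x + f y"
    and linear_map_scale: "f (s1 r x) = s2 r (f x)"
    and linear_map_zero: "f 0 = 0"
    and linear_map_sum: "f (sum g A) = (\<Sum>i\<in>A. f (g i))"
    and linear_map_vector_space: "vector_space s2"
proof -
  interpret module_hom s1 s2 f
    using assms by (simp only: module_hom_iff_linear)
  show "f (x + y) = f x + f y" "f (s1 r x) = s2 r (f x)" "f 0 = 0" "f (sum g A) = (\<Sum>i\<in>A. f (g i))"
    by (simp_all add: add scale sum)
  show "vector_space s2"
    using assms by (simp add: Vector_Spaces.linear_iff)
qed

definition bilinear_map ::
    "('k::field \<Rightarrow> 'a::ab_group_add \<Rightarrow> 'a) \<Rightarrow> ('k \<Rightarrow> 'v::ab_group_add \<Rightarrow> 'v) \<Rightarrow> ('a \<Rightarrow> 'a \<Rightarrow> 'v) \<Rightarrow> bool" where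
  "bilinear_map s sv \<beta> \<longleftrightarrow>
     (\<forall>b. Vector_Spaces.linear s sv (\<lambda>a. \<beta> a b)) \<and> (\<forall>a. Vector_Spaces.linear s sv (\<beta> a))"

lemma bilinear_mapI:
  assumes "vector_space s" "vector_space sv"
    and "\<And>a a' b. \<beta> (a + a') b = \<beta> a b + \<beta> a' b" "\<And>r a b. \<beta> (s r a) b = sv r (\<beta> a b)"
    and "\<And>a b b'. \<beta> a (b + b') = \<beta> a b + \<beta> a b'" "\<And>r a b. \<beta> a (s r b) = sv r (\<beta> a b)"
  shows "bilinear_map s sv \<beta>"
  using assms by (simp add: bilinear_map_def Vector_Spaces.linear_iff)

lemma bilinear_mapD:
  assumes "bilinear_map s sv \<beta>"
  shows bilinear_map_left: "Vector_Spaces.linear s sv (\<lambda>a. \<beta> a b)"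
    and bilinear_map_right: "Vector_Spaces.linear s sv (\<beta> a)"
  using assms by (simp_all add: bilinear_map_def)

lemma bilinear_map_swap: "bilinear_map s sv \<beta> \<Longrightarrow> bilinear_map s sv (\<lambda>a b. \<beta> b a)"
  by (simp add: bilinear_map_def)

lemma lin_ext_superset:
  assumes "vector_space s" "finite A" "Poly_Mapping.keys f \<subseteq> A"
  shows "lin_ext s \<phi> f = (\<Sum>x\<in>A. s (Poly_Mapping.lookup f x) (\<phi> x))"
proof -
  interpret vector_space s by fact
  show ?thesis
    unfolding lin_ext_def using assms(2,3)
    by (intro sum.mono_neutral_left) (auto simp: not_in_keys_iff_lookup_eq_zero)
qed

lemma lin_ext_cong:
  "(\<And>x. x \<in> Poly_Mapping.keys f \<Longrightarrow> \<phi> x = \<psi> x) \<Longrightarrow> lin_ext s \<phi> f = lin_ext s \<psi> f"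
  by (simp add: lin_ext_def)

lemma linear_lin_ext:
  fixes s :: "'k::field \<Rightarrow> 'v::ab_group_add \<Rightarrow> 'v" and \<phi> :: "'x \<Rightarrow> 'v"
  assumes "vector_space s"
  shows "Vector_Spaces.linear free_scale s (lin_ext s \<phi>)"
proof (rule linearI[OF vector_space_free_scale assms])
  interpret vector_space s by fact
  fix f g :: "'x \<Rightarrow>\<^sub>0 'k" and r
  let ?A = "Poly_Mapping.keys f \<union> Poly_Mapping.keys g"
  have "lin_ext s \<phi> (f + g) = (\<Sum>x\<in>?A. s (Poly_Mapping.lookup (f + g) x) (\<phi> x))"
    using Poly_Mapping.keys_add[of f g] by (intro lin_ext_superset assms) auto
  also have "\<dots> = lin_ext s \<phi> f + lin_ext s \<phi> g"
    by (simp add: lin_ext_superset[OF assms, of ?A] lookup_add scale_left_distrib sum.distrib)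
  finally show "lin_ext s \<phi> (f + g) = lin_ext s \<phi> f + lin_ext s \<phi> g" .
  have "lin_ext s \<phi> (free_scale r f)
      = (\<Sum>x\<in>Poly_Mapping.keys f. s (Poly_Mapping.lookup (free_scale r f) x) (\<phi> x))"
    by (intro lin_ext_superset assms) (auto simp: in_keys_iff)
  then show "lin_ext s \<phi> (free_scale r f) = s r (lin_ext s \<phi> f)"
    by (simp add: lin_ext_def scale_sum_right)
qed

lemma lin_ext_single:
  assumes "vector_space s"
  shows "lin_ext s \<phi> (Poly_Mapping.single x r) = s r (\<phi> x)"
  using lin_ext_superset[OF assms, of "{x}" "Poly_Mapping.single x r" \<phi>] by simp

lemma linear_lin_ext_comp:
  assumes "Vector_Spaces.linear s1 s2 u"
  shows "u (lin_ext s1 \<phi> f) = lin_ext s2 (\<lambda>x. u (\<phi> x)) f"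
  by (simp add: lin_ext_def linear_map_sum[OF assms] linear_map_scale[OF assms])

lemma lin_ext_add_right:
  assumes "vector_space s"
  shows "lin_ext s (\<lambda>x. \<phi> x + \<psi> x) f = lin_ext s \<phi> f + lin_ext s \<psi> f"
proof -
  interpret vector_space s by fact
  show ?thesis
    by (simp add: lin_ext_def scale_right_distrib sum.distrib)
qed

lemma lin_ext_sum_right:
  assumes "vector_space s"
  shows "lin_ext s (\<lambda>x. \<Sum>i\<in>I. \<phi> i x) f = (\<Sum>i\<in>I. lin_ext s (\<phi> i) f)"
proof -
  interpret vector_space s by fact
  show ?thesis
    unfolding lin_ext_def scale_sum_right by (rule sum.swap)
qed

lemma lin_ext_scale_right:
  assumes "vector_space s"
  shows "lin_ext s (\<lambda>x. s r (\<phi> x)) f = s r (lin_ext s \<phi> f)"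
proof -
  interpret vector_space s by fact
  show ?thesis
    by (simp add: lin_ext_def scale_sum_right mult.commute)
qed

text \<open>Bilinear maps factor through the tensor square: the linear extension kills each
  generating relation, hence their span.\<close>

lemma lin_ext_bilinear_relations:
  assumes "bilinear_map s sv \<beta>" "f \<in> bilinear_relations s"
  shows "lin_ext sv (\<lambda>(a, b). \<beta> a b) f = 0"
proof -
  note lin = bilinear_mapD[OF assms(1)]
  have vs: "vector_space sv"
    using linear_map_vector_space[OF lin(1)] .
  interpret sv: vector_space sv by fact
  interpret L: module_hom free_scale sv "lin_ext sv (\<lambda>(a, b). \<beta> a b)"
    unfolding module_hom_iff_linear by (rule linear_lin_ext[OF vs])
  show ?thesis
    by (rule L.eq_0_on_span[OF _ assms(2)[unfolded bilinear_relations_def]])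
      (auto simp: L.diff L.scale lin_ext_single[OF vs] linear_map_add[OF lin(1)] linear_map_add[OF lin(2)]
         linear_map_scale[OF lin(1)] linear_map_scale[OF lin(2)])
qed

lemma lin_ext_trilinear_relations:
  assumes "vector_space sv" "\<And>b c. Vector_Spaces.linear s sv (\<lambda>a. \<gamma> a b c)"
    "\<And>a c. Vector_Spaces.linear s sv (\<lambda>b. \<gamma> a b c)" "\<And>a b. Vector_Spaces.linear s sv (\<lambda>c. \<gamma> a b c)"
    "f \<in> trilinear_relations s"
  shows "lin_ext sv (\<lambda>(a, b, c). \<gamma> a b c) f = 0"
proof -
  interpret sv: vector_space sv by fact
  interpret L: module_hom free_scale sv "lin_ext sv (\<lambda>(a, b, c). \<gamma> a b c)"
    unfolding module_hom_iff_linear by (rule linear_lin_ext[OF assms(1)])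
  show ?thesis
    by (rule L.eq_0_on_span[OF _ assms(5)[unfolded trilinear_relations_def]])
      (auto simp: L.diff L.scale lin_ext_single[OF assms(1)] linear_map_add[OF assms(2)]
         linear_map_add[OF assms(3)] linear_map_add[OF assms(4)]
         linear_map_scale[OF assms(2)] linear_map_scale[OF assms(3)] linear_map_scale[OF assms(4)])
qed

text \<open>The element \<open>\<Sum> \<beta> x\<^sub>(\<^sub>1\<^sub>) x\<^sub>(\<^sub>2\<^sub>)\<close>; its independence of the representative is \<open>sweedler_eq\<close>.\<close>

definition sweedler ::
    "('a \<Rightarrow> ('a \<times> 'a \<Rightarrow>\<^sub>0 'k::field) set) \<Rightarrow> ('k \<Rightarrow> 'v::ab_group_add \<Rightarrow> 'v) \<Rightarrow> ('a \<Rightarrow> 'a \<Rightarrow> 'v) \<Rightarrow> 'a \<Rightarrow> 'v" where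
  "sweedler \<Delta> sv \<beta> x = lin_ext sv (\<lambda>(a, b). \<beta> a b) (SOME f. f \<in> \<Delta> x)"

lemma linear_sweedler_comp:
  assumes "Vector_Spaces.linear s1 s2 u"
  shows "u (sweedler \<Delta> s1 \<beta> x) = sweedler \<Delta> s2 (\<lambda>a b. u (\<beta> a b)) x"
  by (simp add: sweedler_def linear_lin_ext_comp[OF assms] case_prod_unfold)

lemma sweedler_sum_right:
  assumes "vector_space sv"
  shows "sweedler \<Delta> sv (\<lambda>a b. \<Sum>i\<in>I. \<beta> i a b) x = (\<Sum>i\<in>I. sweedler \<Delta> sv (\<beta> i) x)"
  by (simp add: sweedler_def lin_ext_sum_right[OF assms] case_prod_unfold)

lemma sweedler_add_right:
  assumes "vector_space sv"
  shows "sweedler \<Delta> sv (\<lambda>a b. \<beta> a b + \<gamma> a b) x = sweedler \<Delta> sv \<beta> x + sweedler \<Delta> sv \<gamma> x"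
  by (simp add: sweedler_def lin_ext_add_right[OF assms] case_prod_unfold)

lemma sweedler_scale_right:
  assumes "vector_space sv"
  shows "sweedler \<Delta> sv (\<lambda>a b. sv r (\<beta> a b)) x = sv r (sweedler \<Delta> sv \<beta> x)"
  by (simp add: sweedler_def lin_ext_scale_right[OF assms] case_prod_unfold)

text \<open>The two actions of the dual algebra on a coalgebra. The side in the name is the tensor
  factor that the form consumes; the other factor is returned.\<close>

definition contract_right where
  "contract_right \<Delta> s f x = sweedler \<Delta> s (\<lambda>a b. s (f b) a) x"

definition contract_left where
  "contract_left \<Delta> s f x = sweedler \<Delta> s (\<lambda>a b. s (f a) b) x"

definition contractions where
  "contractions \<Delta> s = {contract_right \<Delta> s f | f. Vector_Spaces.linear s (*) f} \<union>
     {contract_left \<Delta> s f | f. Vector_Spaces.linear s (*) f}"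

section \<open>The coproduct seen through bilinear maps\<close>

context coalgebra
begin

lemma vector_space_scale: "vector_space scale"
  by unfold_locales

lemma comult_nonempty: "(SOME f. f \<in> \<Delta> x) \<in> \<Delta> x"
proof -
  interpret Fr: vector_space "free_scale :: 'k \<Rightarrow> ('a \<times> 'a \<Rightarrow>\<^sub>0 'k) \<Rightarrow> _"
    by (rule vector_space_free_scale)
  obtain f where f: "\<Delta> x = f +o bilinear_relations scale"
    using comult_in_tensor_square[of x] unfolding tensor_square_def by blast
  have "0 \<in> bilinear_relations scale"
    unfolding bilinear_relations_def by (rule Fr.span_zero)
  then have "f + 0 \<in> \<Delta> x"
    unfolding f by (rule set_plus_intro2)
  then show ?thesis
    by (rule someI)
qed

lemma comult_diff:
  assumes "f \<in> \<Delta> x" "g \<in> \<Delta> x"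
  shows "f - g \<in> bilinear_relations scale"
proof -
  interpret Fr: vector_space "free_scale :: 'k \<Rightarrow> ('a \<times> 'a \<Rightarrow>\<^sub>0 'k) \<Rightarrow> _"
    by (rule vector_space_free_scale)
  obtain h where h: "\<Delta> x = h +o bilinear_relations scale"
    using comult_in_tensor_square[of x] unfolding tensor_square_def by blast
  obtain u v where "f = h + u" "u \<in> bilinear_relations scale" "g = h + v" "v \<in> bilinear_relations scale"
    using assms unfolding h elt_set_plus_def by blast
  then show ?thesis
    using Fr.span_diff[of u _ v] by (simp add: bilinear_relations_def)
qed

lemma comult_add_relation:
  assumes "f \<in> \<Delta> x" "g - f \<in> bilinear_relations scale"
  shows "g \<in> \<Delta> x"
proof -
  interpret Fr: vector_space "free_scale :: 'k \<Rightarrow> ('a \<times> 'a \<Rightarrow>\<^sub>0 'k) \<Rightarrow> _"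
    by (rule vector_space_free_scale)
  obtain h where h: "\<Delta> x = h +o bilinear_relations scale"
    using comult_in_tensor_square[of x] unfolding tensor_square_def by blast
  obtain u where u: "f = h + u" "u \<in> bilinear_relations scale"
    using assms(1) unfolding h elt_set_plus_def by blast
  have "h + (u + (g - f)) \<in> \<Delta> x"
    unfolding h using u(2) assms(2) Fr.span_add
    by (intro set_plus_intro2) (simp add: bilinear_relations_def)
  then show ?thesis
    by (simp add: u(1))
qed

lemma sweedler_eq:
  assumes "bilinear_map scale sv \<beta>" "f \<in> \<Delta> x"
  shows "sweedler \<Delta> sv \<beta> x = lin_ext sv (\<lambda>(a, b). \<beta> a b) f"
proof -
  have vs: "vector_space sv"
    using linear_map_vector_space[OF bilinear_map_left[OF assms(1)]] .
  interpret L: module_hom free_scale sv "lin_ext sv (\<lambda>(a, b). \<beta> a b)"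
    unfolding module_hom_iff_linear by (rule linear_lin_ext[OF vs])
  show ?thesis
    using lin_ext_bilinear_relations[OF assms(1) comult_diff[OF comult_nonempty assms(2)]]
    by (simp add: sweedler_def L.diff)
qed

lemma linear_sweedler:
  assumes "bilinear_map scale sv \<beta>"
  shows "Vector_Spaces.linear scale sv (sweedler \<Delta> sv \<beta>)"
proof -
  have vs: "vector_space sv"
    using linear_map_vector_space[OF bilinear_map_left[OF assms(1)]] .
  interpret L: module_hom free_scale sv "lin_ext sv (\<lambda>(a, b). \<beta> a b)"
    unfolding module_hom_iff_linear by (rule linear_lin_ext[OF vs])
  show ?thesis
  proof (rule linearI[OF vector_space_scale vs])
    fix x y r
    show "sweedler \<Delta> sv \<beta> (x + y) = sweedler \<Delta> sv \<beta> x + sweedler \<Delta> sv \<beta> y"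
      using sweedler_eq[OF assms comult_add[OF comult_nonempty comult_nonempty], of x y]
      by (simp add: sweedler_def L.add)
    show "sweedler \<Delta> sv \<beta> (scale r x) = sv r (sweedler \<Delta> sv \<beta> x)"
      using sweedler_eq[OF assms comult_scale[OF comult_nonempty], of r x]
      by (simp add: sweedler_def L.scale)
  qed
qed

lemma sweedler_counit:
  shows sweedler_counit_left: "sweedler \<Delta> scale (\<lambda>a b. scale (\<epsilon> a) b) x = x"
    and sweedler_counit_right: "sweedler \<Delta> scale (\<lambda>a b. scale (\<epsilon> b) a) x = x"
  unfolding sweedler_def by (rule counit_left[OF comult_nonempty] counit_right[OF comult_nonempty])+

text \<open>The linear extension of a trilinear map vanishes on the relations, so applying it to the
  coassociativity axiom turns the congruence of formal sums into an equation.\<close>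

lemma sweedler_coassoc:
  assumes vs: "vector_space sv" and "\<And>b c. Vector_Spaces.linear scale sv (\<lambda>a. \<gamma> a b c)"
    "\<And>a c. Vector_Spaces.linear scale sv (\<lambda>b. \<gamma> a b c)" "\<And>a b. Vector_Spaces.linear scale sv (\<lambda>c. \<gamma> a b c)"
  shows "sweedler \<Delta> sv (\<lambda>a b. sweedler \<Delta> sv (\<lambda>a1 a2. \<gamma> a1 a2 b) a) x
    = sweedler \<Delta> sv (\<lambda>a b. sweedler \<Delta> sv (\<lambda>b1 b2. \<gamma> a b1 b2) b) x"
proof -
  \<comment> \<open>The choice of representatives in the axiom must be the one built into
    \<open>sweedler\<close>, so that the iterated sums unfold to the same expressions.\<close>
  define \<delta> where "\<delta> y = (SOME f. f \<in> \<Delta> y)" for y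
  have \<delta>: "\<delta> y \<in> \<Delta> y" for y
    unfolding \<delta>_def by (rule comult_nonempty)
  define G where "G = (\<lambda>(a, b, c). \<gamma> a b c)"
  have G: "G p = \<gamma> (fst p) (fst (snd p)) (snd (snd p))" for p
    by (simp add: G_def case_prod_unfold)
  note lin = linear_lin_ext[OF vs, of G]
  interpret sv: vector_space sv by fact
  interpret L: module_hom free_scale sv "lin_ext sv G"
    unfolding module_hom_iff_linear by (rule lin)
  have "lin_ext sv G (lin_ext free_scale (\<lambda>(a, b). lin_ext free_scale (\<lambda>(a1, a2). triple_tensor a1 a2 b) (\<delta> a)) (\<delta> x))
    = lin_ext sv G (lin_ext free_scale (\<lambda>(a, b). lin_ext free_scale (\<lambda>(b1, b2). triple_tensor a b1 b2) (\<delta> b)) (\<delta> x))"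
    using lin_ext_trilinear_relations[OF assms coassoc[of \<delta>, OF \<delta>, of x]]
    unfolding G_def[symmetric] L.diff by simp
  then show ?thesis
    by (simp add: linear_lin_ext_comp[OF lin] case_prod_unfold lin_ext_single[OF vs] sweedler_def \<delta>_def G)
qed

lemma sweedler_cocommutative:
  assumes "cocommutative \<Delta>" "bilinear_map scale sv \<beta>"
  shows "sweedler \<Delta> sv (\<lambda>a b. \<beta> b a) x = sweedler \<Delta> sv \<beta> x"
proof -
  have vs: "vector_space sv"
    using linear_map_vector_space[OF bilinear_map_left[OF assms(2)]] .
  have "lin_ext free_scale (\<lambda>(a, b). pair_tensor b a) (SOME f. f \<in> \<Delta> x) \<in> \<Delta> x"
    using assms(1) comult_nonempty unfolding cocommutative_def by blast
  from sweedler_eq[OF assms(2) this] show ?thesis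
    using vs by (simp add: linear_lin_ext_comp[OF linear_lin_ext[OF vs]] case_prod_unfold lin_ext_single
        sweedler_def vector_space.vector_space_assms)
qed

text \<open>Bilinear forms separate the points of the tensor square. If \<open>g\<close> were in
  another coset, its difference \<open>d\<close> from a representative would lie outside the
  relations, and some linear form would vanish on the relations but not at \<open>d\<close>; on pure
  tensors this form is bilinear.\<close>

lemma comult_memI:
  assumes "\<And>\<beta>. bilinear_map scale (*) \<beta> \<Longrightarrow> lin_ext (*) (\<lambda>(a, b). \<beta> a b) g = sweedler \<Delta> (*) \<beta> x"
  shows "g \<in> \<Delta> x"
proof (rule ccontr)
  assume "g \<notin> \<Delta> x"
  let ?f = "SOME f. f \<in> \<Delta> x"
  let ?R = "bilinear_relations scale"
  interpret Fr: vector_space "free_scale :: 'k \<Rightarrow> ('a \<times> 'a \<Rightarrow>\<^sub>0 'k) \<Rightarrow> _"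
    by (rule vector_space_free_scale)
  interpret K: vector_space "(*) :: 'k \<Rightarrow> 'k \<Rightarrow> 'k"
    by (rule vector_space_field)
  interpret FK: vector_space_pair "free_scale :: 'k \<Rightarrow> ('a \<times> 'a \<Rightarrow>\<^sub>0 'k) \<Rightarrow> _" "(*) :: 'k \<Rightarrow> 'k \<Rightarrow> 'k"
    by unfold_locales
  define d where "d = g - ?f"
  have d: "d \<notin> ?R"
    using comult_add_relation[OF comult_nonempty, of g x] \<open>g \<notin> \<Delta> x\<close> by (auto simp: d_def)
  have subR: "Fr.subspace ?R"
    unfolding bilinear_relations_def by (rule Fr.subspace_span)
  obtain B where B: "B \<subseteq> ?R" "Fr.independent B" "?R \<subseteq> Fr.span B"
    by (rule Fr.basis_exists)
  have spB: "Fr.span B = ?R"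
    by (rule Fr.span_subspace[OF B(1,3) subR])
  have "Fr.independent (insert d B)"
    using d B(2) spB by (intro Fr.independent_insertI) auto
  from FK.linear_independent_extend[OF this, of "\<lambda>y. if y = d then 1 else 0"]
  obtain \<phi> where \<phi>: "Vector_Spaces.linear free_scale (*) \<phi>"
      "\<forall>y\<in>insert d B. \<phi> y = (if y = d then 1 else 0)"
    by blast
  interpret \<phi>: module_hom free_scale "(*)" \<phi>
    unfolding module_hom_iff_linear by (rule \<phi>(1))
  have "\<phi> y = 0" if "y \<in> B" for y
    using \<phi>(2) that d B(1) by auto
  then have \<phi>R: "\<phi> y = 0" if "y \<in> ?R" for y
    using \<phi>.eq_0_on_span[of B y] that spB by blast
  \<comment> \<open>Vanishing of \<open>\<phi>\<close> on the relations is what makes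
    \<open>\<beta>\<close> bilinear, and \<open>\<phi>\<close> is recovered from
    \<open>\<beta>\<close> since pure tensors are the basis of the free space.\<close>
  define \<beta> where "\<beta> a b = \<phi> (pair_tensor a b)" for a b
  have \<phi>_eq: "\<phi> f = lin_ext (*) (\<lambda>(a, b). \<beta> a b) f" for f
  proof -
    have "f = lin_ext free_scale (\<lambda>(a, b). pair_tensor a b) f"
      by (rule poly_mapping_eqI)
        (simp add: lin_ext_def lookup_sum lookup_single case_prod_unfold when_def in_keys_iff
          if_distrib cong: if_cong)
    then have "\<phi> f = \<phi> (lin_ext free_scale (\<lambda>(a, b). pair_tensor a b) f)"
      by simp
    then show ?thesis
      by (simp add: linear_lin_ext_comp[OF \<phi>(1)] \<beta>_def case_prod_unfold)
  qed
  have "bilinear_map scale (*) \<beta>"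
  proof (rule bilinear_mapI[OF vector_space_scale vector_space_field])
    fix a a' b b' r
    have "pair_tensor (a + a') b - pair_tensor a b - pair_tensor a' b \<in> ?R"
      "pair_tensor a (b + b') - pair_tensor a b - pair_tensor a b' \<in> ?R"
      "pair_tensor (scale r a) b - free_scale r (pair_tensor a b) \<in> ?R"
      "pair_tensor a (scale r b) - free_scale r (pair_tensor a b) \<in> ?R"
      unfolding bilinear_relations_def by (rule Fr.span_base; blast)+
    from this[THEN \<phi>R]
    show "\<beta> (a + a') b = \<beta> a b + \<beta> a' b" "\<beta> a (b + b') = \<beta> a b + \<beta> a b'"
      "\<beta> (scale r a) b = r * \<beta> a b" "\<beta> a (scale r b) = r * \<beta> a b"
      by (simp_all add: \<beta>_def \<phi>.diff \<phi>.add \<phi>.scale algebra_simps)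
  qed
  from assms[OF this] have "\<phi> g = \<phi> ?f"
    by (simp add: \<phi>_eq sweedler_def)
  then have "\<phi> d = 0"
    by (simp add: d_def \<phi>.diff)
  then show False
    using \<phi>(2) by simp
qed

end

section \<open>Subcoalgebras as stable subspaces\<close>

context vector_space
begin

lemma extend_to_basis:
  assumes "independent B0"
  obtains B where "B0 \<subseteq> B" "independent B" "span B = UNIV"
  using maximal_independent_subset_extend[OF subset_UNIV assms] by (metis top.extremum_uniqueI)

lemma sum_representation_superset:
  assumes "independent B" "x \<in> span B" "finite X" "{b. representation B x b \<noteq> 0} \<subseteq> X"
  shows "(\<Sum>b\<in>X. scale (representation B x b) b) = x"
proof -
  have "(\<Sum>b\<in>X. scale (representation B x b) b)
      = (\<Sum>b | representation B x b \<noteq> 0. scale (representation B x b) b)"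
    by (rule sum.mono_neutral_right) (use assms(3,4) in auto)
  then show ?thesis
    using sum_nonzero_representation_eq[OF assms(1,2)] by simp
qed

end

context coalgebra
begin

lemma bilinear_contract:
  assumes "Vector_Spaces.linear scale (*) f"
  shows "bilinear_map scale scale (\<lambda>a b. scale (f b) a)" "bilinear_map scale scale (\<lambda>a b. scale (f a) b)"
  by (rule bilinear_mapI[OF vector_space_scale vector_space_scale];
      simp add: linearD(1,2)[OF assms] scale_left_distrib scale_right_distrib mult.commute)+

lemma linear_contract:
  assumes "Vector_Spaces.linear scale (*) f"
  shows linear_contract_right: "Vector_Spaces.linear scale scale (contract_right \<Delta> scale f)"
    and linear_contract_left: "Vector_Spaces.linear scale scale (contract_left \<Delta> scale f)"
  using linear_sweedler[OF bilinear_contract(1)[OF assms]] linear_sweedler[OF bilinear_contract(2)[OF assms]]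
  by (simp_all add: contract_right_def[abs_def] contract_left_def[abs_def])

lemma linear_contractions: "p \<in> contractions \<Delta> scale \<Longrightarrow> Vector_Spaces.linear scale scale p"
  unfolding contractions_def using linear_contract by blast

section \<open>Convolution of forms and composition of contractions\<close>

lemma bilinear_product_form:
  assumes "Vector_Spaces.linear scale (*) f" "Vector_Spaces.linear scale (*) g"
  shows "bilinear_map scale (*) (\<lambda>a b. f a * g b)"
  by (rule bilinear_mapI[OF vector_space_scale vector_space_field])
    (simp_all add: linearD(1,2)[OF assms(1)] linearD(1,2)[OF assms(2)] algebra_simps)

lemma linear_scale_form:
  "Vector_Spaces.linear (*) scale (\<lambda>r. scale r x)"
  by (rule linearI[OF vector_space_field vector_space_scale]) (simp_all add: scale_left_distrib)

text \<open>By coassociativity, two contractions on the same side compose to the contraction with a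
  convolution product of forms. This keeps the set of contracted elements closed when a
  finite-dimensional stable subspace is generated.\<close>

lemma contract_left_left:
  assumes f: "Vector_Spaces.linear scale (*) f" and g: "Vector_Spaces.linear scale (*) g"
  shows "contract_left \<Delta> scale g (contract_left \<Delta> scale f x)
    = contract_left \<Delta> scale (sweedler \<Delta> (*) (\<lambda>a b. f a * g b)) x"
proof -
  have "contract_left \<Delta> scale g (contract_left \<Delta> scale f x)
    = sweedler \<Delta> scale (\<lambda>a b. scale (f a) (contract_left \<Delta> scale g b)) x"
    unfolding contract_left_def[of _ _ f] linear_sweedler_comp[OF linear_contract_left[OF g]]
    by (simp add: linearD(2)[OF linear_contract_left[OF g]])
  also have "\<dots> = sweedler \<Delta> scale (\<lambda>a b. sweedler \<Delta> scale (\<lambda>b1 b2. scale (f a * g b1) b2) b) x"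
    by (simp add: contract_left_def sweedler_scale_right[OF vector_space_scale, symmetric])
  also have "\<dots> = sweedler \<Delta> scale (\<lambda>a b. sweedler \<Delta> scale (\<lambda>a1 a2. scale (f a1 * g a2) b) a) x"
    by (rule sweedler_coassoc[where \<gamma> = "\<lambda>a b c. scale (f a * g b) c", OF vector_space_scale, symmetric];
        rule linearI[OF vector_space_scale vector_space_scale];
        simp add: linearD(1,2)[OF f] linearD(1,2)[OF g] algebra_simps)
  also have "\<dots> = contract_left \<Delta> scale (sweedler \<Delta> (*) (\<lambda>a b. f a * g b)) x"
    unfolding contract_left_def
    by (rule arg_cong[where f = "\<lambda>\<beta>. sweedler \<Delta> scale \<beta> x"], intro ext)
      (simp add: linear_sweedler_comp[OF linear_scale_form])
  finally show ?thesis .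
qed

lemma contract_right_right:
  assumes f: "Vector_Spaces.linear scale (*) f" and g: "Vector_Spaces.linear scale (*) g"
  shows "contract_right \<Delta> scale g (contract_right \<Delta> scale f x)
    = contract_right \<Delta> scale (sweedler \<Delta> (*) (\<lambda>a b. g a * f b)) x"
proof -
  have "contract_right \<Delta> scale g (contract_right \<Delta> scale f x)
    = sweedler \<Delta> scale (\<lambda>a b. scale (f b) (contract_right \<Delta> scale g a)) x"
    unfolding contract_right_def[of _ _ f] linear_sweedler_comp[OF linear_contract_right[OF g]]
    by (simp add: linearD(2)[OF linear_contract_right[OF g]])
  also have "\<dots> = sweedler \<Delta> scale (\<lambda>a b. sweedler \<Delta> scale (\<lambda>a1 a2. scale (g a2 * f b) a1) a) x"
    by (simp add: contract_right_def sweedler_scale_right[OF vector_space_scale, symmetric] mult.commute)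
  also have "\<dots> = sweedler \<Delta> scale (\<lambda>a b. sweedler \<Delta> scale (\<lambda>b1 b2. scale (g b1 * f b2) a) b) x"
    by (rule sweedler_coassoc[where \<gamma> = "\<lambda>a b c. scale (g b * f c) a", OF vector_space_scale];
        rule linearI[OF vector_space_scale vector_space_scale];
        simp add: linearD(1,2)[OF f] linearD(1,2)[OF g] algebra_simps)
  also have "\<dots> = contract_right \<Delta> scale (sweedler \<Delta> (*) (\<lambda>a b. g a * f b)) x"
    unfolding contract_right_def
    by (simp add: linear_sweedler_comp[OF linear_scale_form])
  finally show ?thesis .
qed

text \<open>By coassociativity, both orders return the middle factor of the twofold coproduct, with
  \<open>f\<close> applied to the first factor and \<open>g\<close> to the last.\<close>

lemma contract_right_left:
  assumes f: "Vector_Spaces.linear scale (*) f" and g: "Vector_Spaces.linear scale (*) g"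
  shows "contract_right \<Delta> scale g (contract_left \<Delta> scale f x)
    = contract_left \<Delta> scale f (contract_right \<Delta> scale g x)"
proof -
  have "contract_right \<Delta> scale g (contract_left \<Delta> scale f x)
    = sweedler \<Delta> scale (\<lambda>a b. scale (f a) (contract_right \<Delta> scale g b)) x"
    unfolding contract_left_def linear_sweedler_comp[OF linear_contract_right[OF g]]
    by (simp add: linearD(2)[OF linear_contract_right[OF g]])
  also have "\<dots> = sweedler \<Delta> scale (\<lambda>a b. sweedler \<Delta> scale (\<lambda>b1 b2. scale (f a * g b2) b1) b) x"
    by (simp add: contract_right_def sweedler_scale_right[OF vector_space_scale, symmetric])
  also have "\<dots> = sweedler \<Delta> scale (\<lambda>a b. sweedler \<Delta> scale (\<lambda>a1 a2. scale (f a1 * g b) a2) a) x"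
    by (rule sweedler_coassoc[where \<gamma> = "\<lambda>a b c. scale (f a * g c) b", OF vector_space_scale, symmetric];
        rule linearI[OF vector_space_scale vector_space_scale];
        simp add: linearD(1,2)[OF f] linearD(1,2)[OF g] algebra_simps)
  also have "\<dots> = sweedler \<Delta> scale (\<lambda>a b. scale (g b) (contract_left \<Delta> scale f a)) x"
    by (simp add: contract_left_def sweedler_scale_right[OF vector_space_scale, symmetric] mult.commute)
  also have "\<dots> = contract_left \<Delta> scale f (contract_right \<Delta> scale g x)"
    unfolding contract_right_def linear_sweedler_comp[OF linear_contract_left[OF f]]
    by (simp add: linearD(2)[OF linear_contract_left[OF f]])
  finally show ?thesis .
qed

section \<open>Local finiteness of coalgebras\<close>

lemma contract_left_in_span:
  "contract_left \<Delta> scale f x \<in> span (snd ` Poly_Mapping.keys (SOME h. h \<in> \<Delta> x))"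
  unfolding contract_left_def sweedler_def lin_ext_def case_prod_unfold
  by (intro span_sum span_scale span_base imageI)

lemma contract_right_in_span:
  "contract_right \<Delta> scale f x \<in> span (fst ` Poly_Mapping.keys (SOME h. h \<in> \<Delta> x))"
  unfolding contract_right_def sweedler_def lin_ext_def case_prod_unfold
  by (intro span_sum span_scale span_base imageI)

text \<open>The finiteness theorem for coalgebras, for a finite set \<open>A\<close>.
  \<open>G\<close> collects all two-sided contractions of elements of \<open>A\<close>; the
  convolution laws make its span stable, and the counit puts \<open>A\<close> into it.\<close>

lemma stable_contractions_finite:
  assumes "finite A"
  obtains C where "stable scale (contractions \<Delta> scale) C" "finite_dimensional scale C" "A \<subseteq> C"
proof -
  define G where "G = {contract_left \<Delta> scale f (contract_right \<Delta> scale g x) | f g x.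
    Vector_Spaces.linear scale (*) f \<and> Vector_Spaces.linear scale (*) g \<and> x \<in> A}"
  \<comment> \<open>Whatever the form, the right contraction of \<open>x\<close> lies in the span of
    the first factors of one fixed representative. Doing the same on the left yields the finite set
    \<open>Z\<close>, whose span bounds \<open>G\<close>.\<close>
  define Y where "Y = (\<Union>x\<in>A. fst ` Poly_Mapping.keys (SOME h. h \<in> \<Delta> x))"
  define Z where "Z = (\<Union>y\<in>Y. snd ` Poly_Mapping.keys (SOME h. h \<in> \<Delta> y))"
  have "finite Z"
    using assms by (simp add: Z_def Y_def)
  have "G \<subseteq> span Z"
  proof
    fix z assume "z \<in> G"
    then obtain f g x where z: "z = contract_left \<Delta> scale f (contract_right \<Delta> scale g x)"
      and f: "Vector_Spaces.linear scale (*) f" and x: "x \<in> A"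
      unfolding G_def by blast
    interpret L: module_hom scale scale "contract_left \<Delta> scale f"
      unfolding module_hom_iff_linear by (rule linear_contract_left[OF f])
    have "fst ` Poly_Mapping.keys (SOME h. h \<in> \<Delta> x) \<subseteq> Y"
      using x unfolding Y_def by blast
    then have "contract_right \<Delta> scale g x \<in> span Y"
      using contract_right_in_span[of g x] span_mono by blast
    then have "z \<in> span (contract_left \<Delta> scale f ` Y)"
      unfolding z L.span_image by (rule imageI)
    moreover have "contract_left \<Delta> scale f y \<in> span Z" if "y \<in> Y" for y
    proof -
      have "snd ` Poly_Mapping.keys (SOME h. h \<in> \<Delta> y) \<subseteq> Z"
        using that unfolding Z_def by blast
      then show ?thesis
        using contract_left_in_span[of f y] span_mono by blast
    qed
    then have "span (contract_left \<Delta> scale f ` Y) \<subseteq> span Z"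
      by (intro span_minimal) auto
    ultimately show "z \<in> span Z"
      by blast
  qed
  then have sub: "span G \<subseteq> span Z"
    by (intro span_minimal) auto
  have "finite_dimensional scale (span Z)"
    unfolding finite_dimensional_def using \<open>finite Z\<close> by (intro exI[of _ Z]) simp
  then have fd: "finite_dimensional scale (span G)"
    by (rule finite_dimensional_subset[OF _ subspace_span sub])
  have "A \<subseteq> G"
  proof
    fix x assume "x \<in> A"
    moreover have "x = contract_left \<Delta> scale \<epsilon> (contract_right \<Delta> scale \<epsilon> x)"
      by (simp add: contract_left_def contract_right_def sweedler_counit)
    ultimately show "x \<in> G"
      unfolding G_def using counit_linear by blast
  qed
  then have A: "A \<subseteq> span G"
    using span_superset by blast
  have "p z \<in> span G" if p: "p \<in> contractions \<Delta> scale" and z: "z \<in> span G" for p z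
  proof -
    interpret p: module_hom scale scale p
      unfolding module_hom_iff_linear by (rule linear_contractions[OF p])
    \<comment> \<open>A left contraction merges with the outer one by convolution; a right
      contraction is first moved past the left one and then merges with the inner one.\<close>
    have "p y \<in> G" if "y \<in> G" for y
    proof -
      obtain f g x where y: "y = contract_left \<Delta> scale f (contract_right \<Delta> scale g x)"
        and fg: "Vector_Spaces.linear scale (*) f" "Vector_Spaces.linear scale (*) g" and x: "x \<in> A"
        using \<open>y \<in> G\<close> unfolding G_def by blast
      from p consider h where "Vector_Spaces.linear scale (*) h" "p = contract_right \<Delta> scale h"
        | h where "Vector_Spaces.linear scale (*) h" "p = contract_left \<Delta> scale h"
        unfolding contractions_def by blast
      then show ?thesis
      proof cases
        case 1
        then have "p y = contract_left \<Delta> scale f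
            (contract_right \<Delta> scale (sweedler \<Delta> (*) (\<lambda>a b. h a * g b)) x)"
          by (simp add: y contract_right_left contract_right_right fg)
        moreover have "Vector_Spaces.linear scale (*) (sweedler \<Delta> (*) (\<lambda>a b. h a * g b))"
          by (intro linear_sweedler bilinear_product_form 1 fg)
        ultimately show ?thesis
          using fg x unfolding G_def by blast
      next
        case 2
        then have "p y = contract_left \<Delta> scale (sweedler \<Delta> (*) (\<lambda>a b. f a * h b))
            (contract_right \<Delta> scale g x)"
          by (simp add: y contract_left_left fg)
        moreover have "Vector_Spaces.linear scale (*) (sweedler \<Delta> (*) (\<lambda>a b. f a * h b))"
          by (intro linear_sweedler bilinear_product_form 2 fg)
        ultimately show ?thesis
          using fg x unfolding G_def by blast
      qed
    qed
    then have "span (p ` G) \<subseteq> span G"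
      by (intro span_mono) blast
    then show ?thesis
      using z unfolding p.span_image by blast
  qed
  then have "stable scale (contractions \<Delta> scale) (span G)"
    unfolding stable_def by blast
  then show thesis
    using that fd A by blast
qed

section \<open>Equivalence of stability and being a subcoalgebra\<close>

lemma subcoalgebra_imp_stable:
  assumes "subcoalgebra scale \<Delta> C"
  shows "stable scale (contractions \<Delta> scale) C"
  unfolding stable_def
proof (intro conjI ballI)
  show sub: "subspace C"
    using assms by (simp add: subcoalgebra_def)
  fix p x assume p: "p \<in> contractions \<Delta> scale" and x: "x \<in> C"
  obtain h where h: "h \<in> \<Delta> x" "Poly_Mapping.keys h \<subseteq> C \<times> C"
    using assms x unfolding subcoalgebra_def by blast
  from p consider f where "Vector_Spaces.linear scale (*) f" "p = contract_right \<Delta> scale f"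
    | f where "Vector_Spaces.linear scale (*) f" "p = contract_left \<Delta> scale f"
    unfolding contractions_def by blast
  then show "p x \<in> C"
  proof cases
    case 1
    show ?thesis
      unfolding 1(2) contract_right_def sweedler_eq[OF bilinear_contract(1)[OF 1(1)] h(1)] lin_ext_def
        case_prod_unfold
      using h(2) by (intro subspace_sum[OF sub] subspace_scale[OF sub]) auto
  next
    case 2
    show ?thesis
      unfolding 2(2) contract_left_def sweedler_eq[OF bilinear_contract(2)[OF 2(1)] h(1)] lin_ext_def
        case_prod_unfold
      using h(2) by (intro subspace_sum[OF sub] subspace_scale[OF sub]) auto
  qed
qed

text \<open>Expanding the first factors in a basis \<open>B\<close> gives \<open>\<Delta> c\<close>
  as the sum of the tensors of \<open>b\<close> with \<open>l b\<close>. Left stability puts each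
  \<open>l b\<close> into \<open>C\<close>; right stability kills \<open>l b\<close> for
  \<open>b\<close> outside the basis \<open>B0\<close> of \<open>C\<close>. What remains is
  supported on pairs from \<open>C\<close>.\<close>

lemma stable_imp_subcoalgebra:
  assumes C: "stable scale (contractions \<Delta> scale) C"
  shows "subcoalgebra scale \<Delta> C"
  unfolding subcoalgebra_def
proof (intro conjI ballI)
  show sub: "subspace C"
    using C by (simp add: stable_def)
  fix c assume c: "c \<in> C"
  obtain B0 where B0: "B0 \<subseteq> C" "independent B0" "C \<subseteq> span B0"
    by (rule basis_exists)
  obtain B where B: "B0 \<subseteq> B" "independent B" "span B = UNIV"
    using extend_to_basis[OF B0(2)] by blast
  define e where "e b v = representation B v b" for b v
  have e: "Vector_Spaces.linear scale (*) (e b)" for b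
    unfolding e_def by (rule linear_representation[OF B(2,3)])
  have e0: "e b v = 0" if "v \<in> C" "b \<notin> B0" for b v
  proof -
    have "representation B v = representation B0 v"
      using that(1) B0(3) by (intro representation_extend[OF B(2) _ B(1)]) blast
    then show ?thesis
      using representation_ne_zero[of B0 v b] that(2) by (auto simp: e_def)
  qed
  let ?f = "SOME f. f \<in> \<Delta> c"
  \<comment> \<open>\<open>B\<close> may be infinite. Only finitely many basis vectors occur in the
    first factors of the chosen representative, and all sums are restricted to these.\<close>
  define X where "X = (\<Union>x\<in>Poly_Mapping.keys ?f. {b. e b (fst x) \<noteq> 0})"
  have "finite X"
    unfolding X_def e_def by (intro finite_UN_I finite_keys finite_representation)
  define l where "l b = contract_left \<Delta> scale (e b) c" for b
  have lC: "l b \<in> C" for b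
    using C c e[of b] unfolding stable_def contractions_def l_def by blast
  have l0: "l b = 0" if "b \<notin> B0" for b
  proof (rule ccontr)
    assume "l b \<noteq> 0"
    interpret K: vector_space_pair scale "(*) :: 'k \<Rightarrow> 'k \<Rightarrow> 'k"
      by (intro vector_space_pair.intro vector_space_scale vector_space_field)
    have "independent {l b}"
      using \<open>l b \<noteq> 0\<close> by simp
    from K.linear_independent_extend[OF this, of "\<lambda>_. 1"]
    obtain \<phi> where \<phi>: "Vector_Spaces.linear scale (*) \<phi>" "\<phi> (l b) = 1"
      by blast
    \<comment> \<open>The forms \<open>e b\<close> and \<open>\<phi>\<close> are applied to the two
      factors of \<open>\<Delta> c\<close>. Contracting with \<open>\<phi>\<close> first gives an
      element of \<open>C\<close>, on which \<open>e b\<close> vanishes.\<close>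
    have "\<phi> (l b) = sweedler \<Delta> (*) (\<lambda>x y. e b x * \<phi> y) c"
      unfolding l_def contract_left_def linear_sweedler_comp[OF \<phi>(1)]
      by (simp add: linearD(2)[OF \<phi>(1)])
    also have "\<dots> = e b (contract_right \<Delta> scale \<phi> c)"
      unfolding contract_right_def linear_sweedler_comp[OF e]
      by (simp add: linearD(2)[OF e] mult.commute)
    also have "\<dots> = 0"
      using C c \<phi>(1) that by (intro e0) (auto simp: stable_def contractions_def)
    finally show False
      using \<phi>(2) by simp
  qed
  define g where "g = (\<Sum>b\<in>X \<inter> B0. pair_tensor b (l b) :: 'a \<times> 'a \<Rightarrow>\<^sub>0 'k)"
  have "Poly_Mapping.keys g \<subseteq> C \<times> C"
  proof -
    have "Poly_Mapping.keys g \<subseteq> (\<Union>b\<in>X \<inter> B0. Poly_Mapping.keys (pair_tensor b (l b) :: 'a \<times> 'a \<Rightarrow>\<^sub>0 'k))"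
      unfolding g_def by (rule Poly_Mapping.keys_sum)
    then show ?thesis
      using lC B0(1) by auto
  qed
  moreover have "g \<in> \<Delta> c"
  proof (rule comult_memI)
    fix \<beta> :: "'a \<Rightarrow> 'a \<Rightarrow> 'k" assume \<beta>: "bilinear_map scale (*) \<beta>"
    note \<beta>l = linearD[OF bilinear_map_left[OF \<beta>]]
    note \<beta>r = linearD[OF bilinear_map_right[OF \<beta>]]
    note lin = linear_lin_ext[OF vector_space_field, of "\<lambda>(a, b). \<beta> a b"]
    have "lin_ext (*) (\<lambda>(a, b). \<beta> a b) g = (\<Sum>b\<in>X \<inter> B0. \<beta> b (l b))"
      unfolding g_def linearD(4)[OF lin] by (simp add: lin_ext_single[OF vector_space_field])
    also have "\<dots> = (\<Sum>b\<in>X. \<beta> b (l b))"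
      by (rule sum.mono_neutral_left) (use \<open>finite X\<close> l0 \<beta>r(3) in auto)
    also have "\<dots> = (\<Sum>b\<in>X. sweedler \<Delta> (*) (\<lambda>x y. \<beta> b (scale (e b x) y)) c)"
      unfolding l_def contract_left_def linear_sweedler_comp[OF bilinear_map_right[OF \<beta>]] ..
    also have "\<dots> = sweedler \<Delta> (*) (\<lambda>x y. \<Sum>b\<in>X. \<beta> b (scale (e b x) y)) c"
      by (rule sweedler_sum_right[OF vector_space_field, symmetric])
    also have "\<dots> = sweedler \<Delta> (*) \<beta> c"
      unfolding sweedler_def
    proof (rule lin_ext_cong)
      fix x assume x: "x \<in> Poly_Mapping.keys ?f"
      have "(\<Sum>b\<in>X. \<beta> b (scale (e b (fst x)) (snd x))) = \<beta> (\<Sum>b\<in>X. scale (e b (fst x)) b) (snd x)"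
        by (simp add: \<beta>l(2,4) \<beta>r(2))
      also have "(\<Sum>b\<in>X. scale (e b (fst x)) b) = fst x"
        unfolding e_def using x \<open>finite X\<close> B(2,3)
        by (intro sum_representation_superset) (auto simp: X_def e_def)
      finally show "(\<lambda>(a, b'). \<Sum>b\<in>X. \<beta> b (scale (e b a) b')) x = (\<lambda>(a, b). \<beta> a b) x"
        by (simp add: case_prod_unfold)
    qed
    finally show "lin_ext (*) (\<lambda>(a, b). \<beta> a b) g = sweedler \<Delta> (*) \<beta> c" .
  qed
  ultimately show "\<exists>f\<in>\<Delta> c. Poly_Mapping.keys f \<subseteq> C \<times> C"
    by blast
qed

end

section \<open>Matrix coefficients and module coalgebras\<close>

text \<open>The coordinate forms of a basis of \<open>F\<close> are taken from a basis of the whole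
  space, so that they are globally linear and can serve as forms in contractions.\<close>

lemma (in vector_space) dual_basis:
  assumes "finite_dimensional scale F"
  obtains I e where "finite I" "I \<subseteq> F" "span I = F" "\<And>i. Vector_Spaces.linear scale (*) (e i)"
    "\<And>a. a \<in> F \<Longrightarrow> (\<Sum>i\<in>I. scale (e i a) i) = a"
    "\<And>i j. j \<in> I \<Longrightarrow> e i j = (if i = j then 1 else 0)"
proof -
  obtain I where I: "finite I" "independent I" "span I = F"
    using finite_dimensional_basis[OF assms] by blast
  obtain B where B: "I \<subseteq> B" "independent B" "span B = UNIV"
    using extend_to_basis[OF I(2)] by blast
  define e where "e i v = representation B v i" for i v
  show thesis
  proof (rule that[of I e])
    show "I \<subseteq> F"
      using I(3) span_superset by blast
    show "Vector_Spaces.linear scale (*) (e i)" for i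
      unfolding e_def by (rule linear_representation[OF B(2,3)])
    show "(\<Sum>i\<in>I. scale (e i a) i) = a" if "a \<in> F" for a
    proof -
      have "representation B a = representation I a"
        using that I(3) by (intro representation_extend[OF B(2) _ B(1)]) simp
      then have "{i. representation B a i \<noteq> 0} \<subseteq> I"
        using representation_ne_zero[of I a] by auto
      then show ?thesis
        unfolding e_def using B(2,3) I(1) by (intro sum_representation_superset) auto
    qed
    show "e i j = (if i = j then 1 else 0)" if "j \<in> I" for i j
      using representation_basis[OF B(2), of j] that B(1) by (auto simp: e_def)
  qed (fact I)+
qed

context coalgebra
begin

text \<open>
  For a dual basis \<open>e\<close> of a finite-dimensional subcoalgebra \<open>F\<close> with basis \<open>I\<close>, the elements
  \<open>contract_left \<Delta> scale (e i) j\<close> are the matrix coefficients of the regular comodule \<open>F\<close>.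
\<close>

lemma sweedler_dual_basis:
  assumes F: "subcoalgebra scale \<Delta> F" and e: "\<And>i. Vector_Spaces.linear scale (*) (e i)"
    and dual: "\<And>a. a \<in> F \<Longrightarrow> (\<Sum>i\<in>I. scale (e i a) i) = a"
    and \<gamma>: "bilinear_map scale sv \<gamma>" and "j \<in> F"
  shows "sweedler \<Delta> sv \<gamma> j = (\<Sum>i\<in>I. \<gamma> i (contract_left \<Delta> scale (e i) j))"
proof -
  note \<gamma>l = linearD[OF bilinear_map_left[OF \<gamma>]]
  note \<gamma>r = linearD[OF bilinear_map_right[OF \<gamma>]]
  have vs: "vector_space sv"
    using \<gamma>l(5) .
  \<comment> \<open>The representative must be supported on \<open>F\<close>, since the dual basis
    expands only elements of \<open>F\<close>.\<close>
  obtain h where h: "h \<in> \<Delta> j" "Poly_Mapping.keys h \<subseteq> F \<times> F"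
    using F \<open>j \<in> F\<close> unfolding subcoalgebra_def by blast
  have bil: "bilinear_map scale sv (\<lambda>a b. \<gamma> i (scale (e i a) b))" for i
    by (rule bilinear_mapI[OF vector_space_scale vs])
      (simp_all add: linearD(1,2)[OF e] \<gamma>r(1,2) scale_left_distrib scale_right_distrib mult.commute
        vector_space.vector_space_assms[OF vs])
  have "sweedler \<Delta> sv \<gamma> j = lin_ext sv (\<lambda>(a, b). \<gamma> a b) h"
    by (rule sweedler_eq[OF \<gamma> h(1)])
  also have "\<dots> = lin_ext sv (\<lambda>x. \<Sum>i\<in>I. (\<lambda>(a, b). \<gamma> i (scale (e i a) b)) x) h"
  proof (rule lin_ext_cong)
    fix x assume "x \<in> Poly_Mapping.keys h"
    then have "fst x \<in> F"
      using h(2) by auto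
    have "\<gamma> (fst x) (snd x) = \<gamma> (\<Sum>i\<in>I. scale (e i (fst x)) i) (snd x)"
      by (simp add: dual[OF \<open>fst x \<in> F\<close>])
    then show "(\<lambda>(a, b). \<gamma> a b) x = (\<Sum>i\<in>I. (\<lambda>(a, b). \<gamma> i (scale (e i a) b)) x)"
      by (simp add: \<gamma>l(2,4) \<gamma>r(2) case_prod_unfold)
  qed
  also have "\<dots> = (\<Sum>i\<in>I. sweedler \<Delta> sv (\<lambda>a b. \<gamma> i (scale (e i a) b)) j)"
    by (simp add: lin_ext_sum_right[OF vs] sweedler_eq[OF bil h(1)])
  also have "\<dots> = (\<Sum>i\<in>I. \<gamma> i (contract_left \<Delta> scale (e i) j))"
    by (simp add: contract_left_def linear_sweedler_comp[OF bilinear_map_right[OF \<gamma>]])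
  finally show ?thesis .
qed

text \<open>The comatrix law: the coproduct of the coefficient at \<open>(p, j)\<close> is the sum
  over \<open>i\<close> of the coefficient at \<open>(p, i)\<close> tensored with the one at
  \<open>(i, j)\<close>.\<close>

lemma sweedler_coefficient:
  assumes F: "subcoalgebra scale \<Delta> F" and e: "\<And>i. Vector_Spaces.linear scale (*) (e i)"
    and dual: "\<And>a. a \<in> F \<Longrightarrow> (\<Sum>i\<in>I. scale (e i a) i) = a"
    and \<beta>: "bilinear_map scale sv \<beta>" and "j \<in> F"
  shows "sweedler \<Delta> sv \<beta> (contract_left \<Delta> scale (e p) j)
    = (\<Sum>i\<in>I. \<beta> (contract_left \<Delta> scale (e p) i) (contract_left \<Delta> scale (e i) j))"
proof -
  note \<beta>l = linearD[OF bilinear_map_left[OF \<beta>]]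
  note \<beta>r = linearD[OF bilinear_map_right[OF \<beta>]]
  note lin = linear_sweedler[OF \<beta>]
  have vs: "vector_space sv"
    using \<beta>l(5) .
  interpret sv: vector_space sv by fact
  have inner: "bilinear_map scale sv (\<lambda>a1 a2. sv (e p a1) (\<beta> a2 b))" for b
    by (rule bilinear_mapI[OF vector_space_scale vs])
      (simp_all add: linearD(1,2)[OF e] \<beta>l(1,2) sv.scale_left_distrib sv.scale_right_distrib mult.commute)
  have outer: "bilinear_map scale sv (\<lambda>a b. sweedler \<Delta> sv (\<lambda>a1 a2. sv (e p a1) (\<beta> a2 b)) a)"
    by (rule bilinear_mapI[OF vector_space_scale vs])
      (simp_all add: linearD(1,2)[OF linear_sweedler[OF inner]] \<beta>r(1,2) sv.scale_right_distrib
        sweedler_add_right[OF vs] sweedler_scale_right[OF vs, symmetric] mult.commute)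
  have "sweedler \<Delta> sv \<beta> (contract_left \<Delta> scale (e p) j)
      = sweedler \<Delta> sv (\<lambda>a b. sv (e p a) (sweedler \<Delta> sv \<beta> b)) j"
    unfolding contract_left_def linear_sweedler_comp[OF lin] by (simp add: linearD(2)[OF lin])
  also have "\<dots> = sweedler \<Delta> sv (\<lambda>a b. sweedler \<Delta> sv (\<lambda>b1 b2. sv (e p a) (\<beta> b1 b2)) b) j"
    by (simp add: sweedler_scale_right[OF vs])
  \<comment> \<open>Coassociativity moves the inner coproduct to the first factor. The outer one is
    then a coproduct of \<open>j\<close>, to be expanded in the dual basis.\<close>
  also have "\<dots> = sweedler \<Delta> sv (\<lambda>a b. sweedler \<Delta> sv (\<lambda>a1 a2. sv (e p a1) (\<beta> a2 b)) a) j"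
    by (rule sweedler_coassoc[where \<gamma> = "\<lambda>a b c. sv (e p a) (\<beta> b c)", OF vs, symmetric];
        rule linearI[OF vector_space_scale vs];
        simp add: linearD(1,2)[OF e] \<beta>l(1,2) \<beta>r(1,2) sv.scale_left_distrib sv.scale_right_distrib mult.commute)
  also have "\<dots> = (\<Sum>i\<in>I. sweedler \<Delta> sv (\<lambda>a1 a2. sv (e p a1) (\<beta> a2 (contract_left \<Delta> scale (e i) j))) i)"
    by (rule sweedler_dual_basis[OF F e dual outer \<open>j \<in> F\<close>])
  also have "\<dots> = (\<Sum>i\<in>I. \<beta> (contract_left \<Delta> scale (e p) i) (contract_left \<Delta> scale (e i) j))"
    unfolding contract_left_def[of _ _ "e p"] linear_sweedler_comp[OF bilinear_map_left[OF \<beta>]]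
    by (simp add: \<beta>l(2))
  finally show ?thesis .
qed

end

section \<open>Contractions on a module coalgebra\<close>

locale cocommutative_hopf_module_coalgebra =
  module_coalgebra scaleH \<Delta>H \<epsilon>H scaleM \<Delta>M \<epsilon>M act + H: hopf_algebra scaleH \<Delta>H \<epsilon>H S
  for scaleH :: "'k::field \<Rightarrow> 'h::ring_1 \<Rightarrow> 'h" and \<Delta>H \<epsilon>H
    and scaleM :: "'k \<Rightarrow> 'm::ab_group_add \<Rightarrow> 'm" and \<Delta>M \<epsilon>M act S +
  assumes cocommutative: "cocommutative \<Delta>H"
begin

lemma act_simps:
  "act (h + h') m = act h m + act h' m" "act (scaleH r h) m = scaleM r (act h m)" "act 0 m = 0"
  "act h (m + m') = act h m + act h m'" "act h (scaleM r m) = scaleM r (act h m)" "act h 0 = 0"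
  "act (\<Sum>i\<in>A. u i) m = (\<Sum>i\<in>A. act (u i) m)" "act h (\<Sum>i\<in>A. v i) = (\<Sum>i\<in>A. act h (v i))"
  using linearD(1-4)[OF act_linear_left] linearD(1-4)[OF act_linear_right] by blast+

lemma linear_form_act:
  "Vector_Spaces.linear scaleM (*) f \<Longrightarrow> Vector_Spaces.linear scaleM (*) (\<lambda>x. f (act h x))"
  by (rule linearI[OF M.vector_space_scale vector_space_field]) (simp_all add: act_simps linearD(1,2))

lemma sweedler_act:
  assumes "bilinear_map scaleM sv \<beta>"
  shows "sweedler \<Delta>M sv \<beta> (act h m)
    = sweedler \<Delta>H sv (\<lambda>h1 h2. sweedler \<Delta>M sv (\<lambda>m1 m2. \<beta> (act h1 m1) (act h2 m2)) m) h"
proof -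
  have vs: "vector_space sv"
    using linear_map_vector_space[OF bilinear_map_left[OF assms]] .
  interpret sv: vector_space sv by fact
  show ?thesis
    using M.sweedler_eq[OF assms comult_act[OF H.comult_nonempty M.comult_nonempty], of h m]
    by (simp add: linear_lin_ext_comp[OF linear_lin_ext[OF vs]] case_prod_unfold lin_ext_single[OF vs]
        sweedler_def)
qed

text \<open>The form absorbs the second factor of \<open>h\<close>, so a contraction of
  \<open>act h m\<close> is built from contractions of \<open>m\<close> by other linear
  forms.\<close>

lemma contract_right_act:
  assumes "Vector_Spaces.linear scaleM (*) f"
  shows "contract_right \<Delta>M scaleM f (act h m)
    = sweedler \<Delta>H scaleM (\<lambda>h1 h2. act h1 (contract_right \<Delta>M scaleM (\<lambda>x. f (act h2 x)) m)) h"
  unfolding contract_right_def sweedler_act[OF M.bilinear_contract(1)[OF assms]]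
  by (simp add: linear_sweedler_comp[OF act_linear_right] act_simps)

lemma contract_left_act:
  assumes "Vector_Spaces.linear scaleM (*) f"
  shows "contract_left \<Delta>M scaleM f (act h m)
    = sweedler \<Delta>H scaleM (\<lambda>h1 h2. act h2 (contract_left \<Delta>M scaleM (\<lambda>x. f (act h1 x)) m)) h"
  unfolding contract_left_def sweedler_act[OF M.bilinear_contract(2)[OF assms]]
  by (simp add: linear_sweedler_comp[OF act_linear_right] act_simps)

end

lemma contract_form:
  assumes "vector_space s"
  shows "contract_right \<Delta> s (\<lambda>x. f x + g x) m = contract_right \<Delta> s f m + contract_right \<Delta> s g m"
    and "contract_right \<Delta> s (\<lambda>x. r * f x) m = s r (contract_right \<Delta> s f m)"
    and "contract_left \<Delta> s (\<lambda>x. f x + g x) m = contract_left \<Delta> s f m + contract_left \<Delta> s g m"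
    and "contract_left \<Delta> s (\<lambda>x. r * f x) m = s r (contract_left \<Delta> s f m)"
proof -
  interpret vector_space s by fact
  show "contract_right \<Delta> s (\<lambda>x. f x + g x) m = contract_right \<Delta> s f m + contract_right \<Delta> s g m"
    "contract_left \<Delta> s (\<lambda>x. f x + g x) m = contract_left \<Delta> s f m + contract_left \<Delta> s g m"
    by (simp_all add: contract_right_def contract_left_def scale_left_distrib
        sweedler_add_right[OF assms])
  show "contract_right \<Delta> s (\<lambda>x. r * f x) m = s r (contract_right \<Delta> s f m)"
    "contract_left \<Delta> s (\<lambda>x. r * f x) m = s r (contract_left \<Delta> s f m)"
    by (simp_all add: contract_right_def contract_left_def
        sweedler_scale_right[OF assms, symmetric])
qed

lemma contract_form_sum:
  assumes "vector_space s"
  shows contract_right_form_sum: "contract_right \<Delta> s (\<lambda>x. \<Sum>i\<in>I. f i x) m = (\<Sum>i\<in>I. contract_right \<Delta> s (f i) m)"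
    and contract_left_form_sum: "contract_left \<Delta> s (\<lambda>x. \<Sum>i\<in>I. f i x) m = (\<Sum>i\<in>I. contract_left \<Delta> s (f i) m)"
proof -
  interpret vector_space s by fact
  show "contract_right \<Delta> s (\<lambda>x. \<Sum>i\<in>I. f i x) m = (\<Sum>i\<in>I. contract_right \<Delta> s (f i) m)"
    "contract_left \<Delta> s (\<lambda>x. \<Sum>i\<in>I. f i x) m = (\<Sum>i\<in>I. contract_left \<Delta> s (f i) m)"
    by (simp_all add: contract_right_def contract_left_def scale_sum_left sweedler_sum_right[OF assms])
qed

section \<open>Transport of maximizers by a comatrix\<close>

context cocommutative_hopf_module_coalgebra
begin

text \<open>Abstracting to any comatrix \<open>T\<close> that is left-inverted by its antipode
  matrix covers both \<open>T = 1\<close> on one index and the coefficients of \<open>F\<close>. The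
  comatrix law is demanded for values in \<open>'m\<close>, where contractions take theirs.\<close>

lemma transport_coefficients:
  fixes T :: "'i \<Rightarrow> 'i \<Rightarrow> 'h"
  assumes "finite I"
    and T_comult: "\<And>(\<beta> :: 'h \<Rightarrow> 'h \<Rightarrow> 'm) i j. bilinear_map scaleH scaleM \<beta> \<Longrightarrow> i \<in> I \<Longrightarrow> j \<in> I \<Longrightarrow>
      sweedler \<Delta>H scaleM \<beta> (T i j) = (\<Sum>l\<in>I. \<beta> (T i l) (T l j))"
    and T_antipode: "\<And>i j. i \<in> I \<Longrightarrow> j \<in> I \<Longrightarrow> (\<Sum>l\<in>I. S (T i l) * T l j) = (if i = j then 1 else 0)"
    and E: "M.subspace E" and E': "M.subspace E'"
    and T_E: "\<And>i j x. i \<in> I \<Longrightarrow> j \<in> I \<Longrightarrow> x \<in> E \<Longrightarrow> act (T i j) x \<in> E'"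
    and C: "stable scaleM (contractions \<Delta>M scaleM) C" "finite_dimensional scaleM C"
    and C': "stable scaleM (contractions \<Delta>M scaleM) C'" "finite_dimensional scaleM C'"
    and max: "\<And>D. stable scaleM (contractions \<Delta>M scaleM) D \<Longrightarrow> finite_dimensional scaleM D \<Longrightarrow>
      int N * int (M.dim (E \<inter> D)) - int k * int (M.dim D)
      \<le> int N * int (M.dim (E \<inter> C)) - int k * int (M.dim C)"
    and max': "\<And>D. stable scaleM (contractions \<Delta>M scaleM) D \<Longrightarrow> finite_dimensional scaleM D \<Longrightarrow>
      int N * int (M.dim (E' \<inter> D)) - int k' * int (M.dim D)
      \<le> int N * int (M.dim (E' \<inter> C')) - int k' * int (M.dim C')"
    and "k' < k" "i \<in> I" "j \<in> I" "c \<in> C"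
  shows "act (T i j) c \<in> C'"
proof -
  let ?P = "contractions \<Delta>M scaleM"
  \<comment> \<open>The matrix \<open>T\<close> acting on column vectors. For the coefficients of
    \<open>F\<close> this is the map sending \<open>h \<otimes> m\<close> to the sum of
    \<open>h1 \<otimes> h2 m\<close>, in coordinates.\<close>
  define g where "g m = (\<lambda>i. if i \<in> I then \<Sum>j\<in>I. act (T i j) (m j) else 0)" for m :: "'i \<Rightarrow> 'm"
  have vsF: "vector_space (scale_fun scaleM :: 'k \<Rightarrow> ('i \<Rightarrow> 'm) \<Rightarrow> _)"
    by (rule vector_space_scale_fun[OF M.vector_space_scale])
  interpret Fn: vector_space "scale_fun scaleM :: 'k \<Rightarrow> ('i \<Rightarrow> 'm) \<Rightarrow> _"
    by (rule vsF)
  have g: "Vector_Spaces.linear (scale_fun scaleM) (scale_fun scaleM) g"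
    by (rule linearI[OF vsF vsF])
      (auto simp: g_def fun_eq_iff scale_fun_def act_simps sum.distrib M.scale_sum_right)
  interpret g: module_hom "scale_fun scaleM" "scale_fun scaleM" g
    unfolding module_hom_iff_linear by (rule g)
  have sub: "M.subspace C" "M.subspace C'"
    using C(1) C'(1) by (simp_all add: stable_def)
  \<comment> \<open>Both contractions of \<open>T i j \<cdot> m\<close> can be written in two ways, as \<open>H\<close> is cocommutative.\<close>
  have contr: "\<exists>Q f. p = Q f \<and> Vector_Spaces.linear scaleM (*) f
      \<and> (\<forall>f. Vector_Spaces.linear scaleM (*) f \<longrightarrow> Q f \<in> ?P
         \<and> (\<forall>i\<in>I. \<forall>j\<in>I. \<forall>m. Q f (act (T i j) m) = (\<Sum>l\<in>I. act (T i l) (Q (\<lambda>x. f (act (T l j) x)) m))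
            \<and> Q f (act (T i j) m) = (\<Sum>l\<in>I. act (T l j) (Q (\<lambda>x. f (act (T i l) x)) m))))
      \<and> (\<forall>A f' m. Q (\<lambda>x. \<Sum>i\<in>A. f' (i::'i) x) m = (\<Sum>i\<in>A. Q (f' i) m))
      \<and> (\<forall>m. Q (\<lambda>x. 0) m = 0)"
    if "p \<in> ?P" for p
  proof -
    have zero: "contract_right \<Delta>M scaleM (\<lambda>x. 0) m = 0" "contract_left \<Delta>M scaleM (\<lambda>x. 0) m = 0" for m
      using contract_right_form_sum[OF M.vector_space_scale, of _ _ "{}"]
        contract_left_form_sum[OF M.vector_space_scale, of _ _ "{}"] by simp_all
    have bil: "bilinear_map scaleH scaleM (\<lambda>h1 h2. act h1 (contract_right \<Delta>M scaleM (\<lambda>x. f (act h2 x)) m))"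
      "bilinear_map scaleH scaleM (\<lambda>h1 h2. act h1 (contract_left \<Delta>M scaleM (\<lambda>x. f (act h2 x)) m))"
      if "Vector_Spaces.linear scaleM (*) f" for f m
      by (rule bilinear_mapI[OF H.vector_space_scale M.vector_space_scale];
          simp add: act_simps linearD(1,2)[OF that] contract_form[OF M.vector_space_scale])+
    \<comment> \<open>For right contractions the first form is the coproduct rule itself and the
      second needs cocommutativity; for left contractions it is the other way round.\<close>
    have right: "contract_right \<Delta>M scaleM f (act (T i j) m)
        = (\<Sum>l\<in>I. act (T i l) (contract_right \<Delta>M scaleM (\<lambda>x. f (act (T l j) x)) m))"
      "contract_right \<Delta>M scaleM f (act (T i j) m)
        = (\<Sum>l\<in>I. act (T l j) (contract_right \<Delta>M scaleM (\<lambda>x. f (act (T i l) x)) m))"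
      if "Vector_Spaces.linear scaleM (*) f" "i \<in> I" "j \<in> I" for f i j m
      unfolding contract_right_act[OF that(1)]
      by (rule T_comult[OF bil(1)[OF that(1)] that(2,3)],
          subst H.sweedler_cocommutative[OF cocommutative bil(1)[OF that(1)], symmetric],
          rule T_comult[OF bilinear_map_swap[OF bil(1)[OF that(1)]] that(2,3)])
    have left: "contract_left \<Delta>M scaleM f (act (T i j) m)
        = (\<Sum>l\<in>I. act (T i l) (contract_left \<Delta>M scaleM (\<lambda>x. f (act (T l j) x)) m))"
      "contract_left \<Delta>M scaleM f (act (T i j) m)
        = (\<Sum>l\<in>I. act (T l j) (contract_left \<Delta>M scaleM (\<lambda>x. f (act (T i l) x)) m))"
      if "Vector_Spaces.linear scaleM (*) f" "i \<in> I" "j \<in> I" for f i j m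
      unfolding contract_left_act[OF that(1)]
      by (subst H.sweedler_cocommutative[OF cocommutative bil(2)[OF that(1)]],
          rule T_comult[OF bil(2)[OF that(1)] that(2,3)],
          rule T_comult[OF bilinear_map_swap[OF bil(2)[OF that(1)]] that(2,3)])
    \<comment> \<open>Letting \<open>Q\<close> be the contraction as a function of its form allows
      both sides to be treated at once in the stability proofs.\<close>
    from that consider f where "Vector_Spaces.linear scaleM (*) f" "p = contract_right \<Delta>M scaleM f"
      | f where "Vector_Spaces.linear scaleM (*) f" "p = contract_left \<Delta>M scaleM f"
      unfolding contractions_def by blast
    then show ?thesis
    proof cases
      case 1
      then show ?thesis
        using right zero contract_right_form_sum[OF M.vector_space_scale]
        by (intro exI[of _ "contract_right \<Delta>M scaleM"] exI[of _ f]) (auto simp: contractions_def)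
    next
      case 2
      then show ?thesis
        using left zero contract_left_form_sum[OF M.vector_space_scale]
        by (intro exI[of _ "contract_left \<Delta>M scaleM"] exI[of _ f]) (auto simp: contractions_def)
    qed
  qed
  note P_lin = M.linear_contractions
  \<comment> \<open>The antipode matrix recovers \<open>m\<close> from \<open>g m\<close>, which
    makes \<open>g\<close> injective.\<close>
  have retract: "(\<Sum>i\<in>I. act (S (T p i)) (g m i)) = m p" if "p \<in> I" for m p
  proof -
    have "(\<Sum>i\<in>I. act (S (T p i)) (g m i)) = (\<Sum>i\<in>I. \<Sum>j\<in>I. act (S (T p i) * T i j) (m j))"
      by (simp add: g_def act_simps act_mult)
    also have "\<dots> = (\<Sum>j\<in>I. act (\<Sum>i\<in>I. S (T p i) * T i j) (m j))"
      by (subst sum.swap) (simp add: act_simps)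
    also have "\<dots> = (\<Sum>j\<in>I. if p = j then m j else 0)"
      by (rule sum.cong) (simp_all add: T_antipode[OF that] act_one act_simps)
    finally show ?thesis
      using that \<open>finite I\<close> by simp
  qed
  have "g ` tuples I C \<subseteq> tuples I C'"
  proof (rule M.maximizer_transport[where P = ?P and E = E and E' = E' and N = N and k = k and k' = k'])
    show "g ` tuples I C \<subseteq> tuples I UNIV"
      by (auto simp: g_def tuples_def)
    show "m = 0" if "m \<in> tuples I C" "g m = 0" for m
    proof
      fix p show "m p = 0 p"
        using retract[of p m] that by (cases "p \<in> I") (auto simp: act_simps tuples_def)
    qed
    show "g ` tuples I E \<subseteq> tuples I E'"
      using T_E by (auto simp: g_def tuples_def intro!: M.subspace_sum[OF E'])
    show "stable (scale_fun scaleM) ((\<circ>) ` ?P) (g ` tuples I C)"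
      unfolding stable_def
    proof (intro conjI ballI)
      show "Fn.subspace (g ` tuples I C)"
        by (rule g.subspace_image[OF M.subspace_tuples[OF sub(1)]])
      fix q :: "('i \<Rightarrow> 'm) \<Rightarrow> 'i \<Rightarrow> 'm" and x assume "q \<in> (\<circ>) ` ?P" "x \<in> g ` tuples I C"
      then obtain p m where p: "p \<in> ?P" "q = (\<circ>) p" and m: "m \<in> tuples I C" "x = g m"
        by blast
      obtain Q f where Q: "p = Q f" "Vector_Spaces.linear scaleM (*) f"
        "\<And>f. Vector_Spaces.linear scaleM (*) f \<Longrightarrow> Q f \<in> ?P"
        "\<And>f i j m. Vector_Spaces.linear scaleM (*) f \<Longrightarrow> i \<in> I \<Longrightarrow> j \<in> I \<Longrightarrow>
          Q f (act (T i j) m) = (\<Sum>l\<in>I. act (T i l) (Q (\<lambda>x. f (act (T l j) x)) m))"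
        using contr[OF p(1)] by blast
      \<comment> \<open>By the first form of the contraction rule, contracting \<open>g m\<close> by
        \<open>f\<close> is \<open>g\<close> applied to a tuple of contractions of the entries of
        \<open>m\<close>, with forms twisted by \<open>T\<close>.\<close>
      define m' where "m' l = (if l \<in> I then \<Sum>j\<in>I. Q (\<lambda>x. f (act (T l j) x)) (m j) else 0)" for l
      have "m' \<in> tuples I C"
        using m(1) C(1) Q(3)[OF linear_form_act[OF Q(2)]]
        by (auto simp: m'_def tuples_def stable_def intro!: M.subspace_sum[OF sub(1)])
      moreover have "q x = g m'"
      proof
        fix i
        show "q x i = g m' i"
        proof (cases "i \<in> I")
          case True
          have "q x i = (\<Sum>j\<in>I. Q f (act (T i j) (m j)))"
            using True by (simp add: p(2) m(2) g_def Q(1)[symmetric] linearD(4)[OF P_lin[OF p(1)]])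
          also have "\<dots> = (\<Sum>j\<in>I. \<Sum>l\<in>I. act (T i l) (Q (\<lambda>x. f (act (T l j) x)) (m j)))"
            using True by (simp add: Q(4)[OF Q(2)])
          also have "\<dots> = (\<Sum>l\<in>I. act (T i l) (m' l))"
            by (subst sum.swap) (simp add: m'_def act_simps)
          finally show ?thesis
            using True by (simp add: g_def)
        next
          case False
          then show ?thesis
            by (simp add: p(2) m(2) g_def linearD(3)[OF P_lin[OF p(1)]])
        qed
      qed
      ultimately show "q x \<in> g ` tuples I C"
        by blast
    qed
    show "stable (scale_fun scaleM) ((\<circ>) ` ?P) {m \<in> tuples I C. g m \<in> tuples I C'}"
      unfolding stable_def
    proof (intro conjI ballI)
      have "{m \<in> tuples I C. g m \<in> tuples I C'} = tuples I C \<inter> {m. g m \<in> tuples I C'}"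
        by auto
      then show "Fn.subspace {m \<in> tuples I C. g m \<in> tuples I C'}"
        using Fn.subspace_inter[OF M.subspace_tuples[OF sub(1)]
            g.subspace_linear_preimage[OF M.subspace_tuples[OF sub(2)]]] by simp
      fix q :: "('i \<Rightarrow> 'm) \<Rightarrow> 'i \<Rightarrow> 'm" and m
      assume "q \<in> (\<circ>) ` ?P" and m: "m \<in> {m \<in> tuples I C. g m \<in> tuples I C'}"
      then obtain p where p: "p \<in> ?P" "q = (\<circ>) p"
        by blast
      obtain Q f where Q: "p = Q f" "Vector_Spaces.linear scaleM (*) f"
        "\<And>f. Vector_Spaces.linear scaleM (*) f \<Longrightarrow> Q f \<in> ?P"
        "\<And>f i j m. Vector_Spaces.linear scaleM (*) f \<Longrightarrow> i \<in> I \<Longrightarrow> j \<in> I \<Longrightarrow>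
          Q f (act (T i j) m) = (\<Sum>l\<in>I. act (T l j) (Q (\<lambda>x. f (act (T i l) x)) m))"
        "\<And>A f' m. Q (\<lambda>x. \<Sum>i\<in>A. f' (i::'i) x) m = (\<Sum>i\<in>A. Q (f' i) m)"
        "\<And>m. Q (\<lambda>x. 0) m = 0"
        using contr[OF p(1)] by blast
      have "q m \<in> tuples I C"
        using m C(1) p linearD(3)[OF P_lin[OF p(1)]] by (auto simp: tuples_def stable_def)
      moreover have "g (q m) a \<in> C'" if a: "a \<in> I" for a
      proof -
        \<comment> \<open>The entries of \<open>g m\<close> lie in the stable space
          \<open>C'\<close>. Contracting the \<open>i\<close>-th one by \<open>f' i\<close> and
          summing, the second form of the contraction rule places \<open>T\<close> next to
          \<open>S\<close> inside the form; they cancel and leave entry \<open>a\<close> of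
          \<open>g (q m)\<close>.\<close>
        define f' where "f' i = (\<lambda>x. f (act (S (T a i)) x))" for i
        have f': "Vector_Spaces.linear scaleM (*) (f' i)" for i
          unfolding f'_def by (rule linear_form_act[OF Q(2)])
        have f'_sum: "(\<Sum>i\<in>I. f' i (act (T i l) x)) = (if a = l then f x else 0)" if "l \<in> I" for l x
        proof -
          have "(\<Sum>i\<in>I. f' i (act (T i l) x)) = f (act (\<Sum>i\<in>I. S (T a i) * T i l) x)"
            by (simp add: f'_def act_simps act_mult linearD(4)[OF Q(2)])
          then show ?thesis
            by (simp add: T_antipode[OF a that] act_one act_simps linearD(3)[OF Q(2)])
        qed
        have "(\<Sum>i\<in>I. Q (f' i) (g m i)) \<in> C'"
          using m C'(1) Q(3)[OF f'] by (intro M.subspace_sum[OF sub(2)]) (auto simp: tuples_def stable_def)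
        also have "(\<Sum>i\<in>I. Q (f' i) (g m i))
            = (\<Sum>i\<in>I. \<Sum>j\<in>I. \<Sum>l\<in>I. act (T l j) (Q (\<lambda>x. f' i (act (T i l) x)) (m j)))"
          by (simp add: g_def linearD(4)[OF P_lin[OF Q(3)[OF f']]] Q(4)[OF f'])
        also have "\<dots> = (\<Sum>j\<in>I. \<Sum>i\<in>I. \<Sum>l\<in>I. act (T l j) (Q (\<lambda>x. f' i (act (T i l) x)) (m j)))"
          by (rule sum.swap)
        also have "\<dots> = (\<Sum>j\<in>I. \<Sum>l\<in>I. \<Sum>i\<in>I. act (T l j) (Q (\<lambda>x. f' i (act (T i l) x)) (m j)))"
          by (rule sum.cong[OF refl], rule sum.swap)
        also have "\<dots> = (\<Sum>j\<in>I. \<Sum>l\<in>I. act (T l j) (Q (\<lambda>x. \<Sum>i\<in>I. f' i (act (T i l) x)) (m j)))"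
          by (simp add: Q(5) act_simps)
        also have "\<dots> = (\<Sum>j\<in>I. \<Sum>l\<in>I. if a = l then act (T a j) (Q f (m j)) else 0)"
        proof (intro sum.cong refl)
          fix j l assume "l \<in> I"
          then have "(\<lambda>x. \<Sum>i\<in>I. f' i (act (T i l) x)) = (if a = l then f else (\<lambda>x. 0))"
            by (simp add: f'_sum fun_eq_iff)
          then show "act (T l j) (Q (\<lambda>x. \<Sum>i\<in>I. f' i (act (T i l) x)) (m j))
              = (if a = l then act (T a j) (Q f (m j)) else 0)"
            by (simp add: Q(6) act_simps)
        qed
        also have "\<dots> = g (q m) a"
          using a \<open>finite I\<close> by (simp add: g_def p(2) Q(1))
        finally show ?thesis .
      qed
      then have "g (q m) \<in> tuples I C'"
        by (simp add: tuples_def g_def)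
      ultimately show "q m \<in> {m \<in> tuples I C. g m \<in> tuples I C'}"
        by simp
    qed
  qed (fact assms P_lin g)+
  \<comment> \<open>With \<open>c\<close> in position \<open>j\<close> and zero elsewhere, entry
    \<open>i\<close> of \<open>g m\<close> is the single term wanted.\<close>
  moreover define m where "m = (\<lambda>l. if l = j then c else 0)"
  have "m \<in> tuples I C"
    using \<open>c \<in> C\<close> \<open>j \<in> I\<close> M.subspace_0[OF sub(1)] by (auto simp: m_def tuples_def)
  ultimately have "g m i \<in> C'"
    using \<open>i \<in> I\<close> by (auto simp: tuples_def)
  moreover have "g m i = (\<Sum>l\<in>I. if l = j then act (T i j) c else 0)"
    using \<open>i \<in> I\<close> by (auto simp: g_def m_def act_simps intro: sum.cong)
  ultimately show ?thesis
    using \<open>finite I\<close> \<open>j \<in> I\<close> by simp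
qed

end

section \<open>Averaging over the levels\<close>

lemma (in vector_space) stable_singleton_0:
  assumes "\<And>p. p \<in> P \<Longrightarrow> Vector_Spaces.linear scale scale p"
  shows "stable scale P {0}"
  using linearD(3)[OF assms] by (simp add: stable_def)

text \<open>The values are integers bounded above by \<open>N\<close> times \<open>dim E\<close>,
  and \<open>{0}\<close> is a candidate, so a maximum exists although there may be infinitely many
  candidates.\<close>

lemma (in vector_space) ex_stable_maximizer:
  assumes "\<And>p. p \<in> P \<Longrightarrow> Vector_Spaces.linear scale scale p" "finite_dimensional scale E"
  obtains C where "stable scale P C" "finite_dimensional scale C"
    "\<And>D. stable scale P D \<Longrightarrow> finite_dimensional scale D \<Longrightarrow>
      int N * int (dim (E \<inter> D)) - int k * int (dim D)
      \<le> int N * int (dim (E \<inter> C)) - int k * int (dim C)"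
proof -
  \<comment> \<open>The distance below the upper bound. It is never negative, so the conversion to a
    natural number loses nothing.\<close>
  define defect where "defect D = nat (int N * int (dim E) - (int N * int (dim (E \<inter> D)) - int k * int (dim D)))" for D
  obtain C where C: "stable scale P C \<and> finite_dimensional scale C"
    and min: "\<And>D. stable scale P D \<and> finite_dimensional scale D \<Longrightarrow> defect C \<le> defect D"
    using ex_has_least_nat[of "\<lambda>D. stable scale P D \<and> finite_dimensional scale D" "{0}" defect]
      stable_singleton_0[OF assms(1)] finite_dimensional_singleton_0 by blast
  have bound: "int N * int (dim (E \<inter> D)) - int k * int (dim D) \<le> int N * int (dim E)" for D
  proof -
    have "int N * int (dim (E \<inter> D)) \<le> int N * int (dim E)"
      using dim_mono_finite_dimensional[OF assms(2), of "E \<inter> D"] by (intro mult_left_mono) simp_all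
    moreover have "0 \<le> int k * int (dim D)"
      by simp
    ultimately show ?thesis
      by linarith
  qed
  show thesis
  proof (rule that[of C])
    fix D assume "stable scale P D" "finite_dimensional scale D"
    then have "defect C \<le> defect D"
      using min by blast
    then show "int N * int (dim (E \<inter> D)) - int k * int (dim D)
        \<le> int N * int (dim (E \<inter> C)) - int k * int (dim C)"
      using bound[of C] bound[of D] by (simp add: defect_def)
  qed (use C in auto)
qed

text \<open>
  With \<open>N\<close> large, \<open>\<Sum> c k / N\<close> approximates the integral of \<open>dim C\<^sub>t\<close> over \<open>0 \<le> t \<le> 1\<close>, where \<open>C\<^sub>t\<close>
  maximizes \<open>dim (E \<inter> C) - t dim C\<close>; the integral is \<open>dim E\<close> as \<open>- dim C\<^sub>t\<close> is the slope of the
  maximal value.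
\<close>

lemma exists_level:
  fixes c e c' e' :: "nat \<Rightarrow> nat \<Rightarrow> nat" and d d' u :: nat
  assumes max: "\<And>N k l. int N * int (e N l) - int k * int (c N l) \<le> int N * int (e N k) - int k * int (c N k)"
    and max': "\<And>N k l. int N * int (e' N l) - int k * int (c' N l) \<le> int N * int (e' N k) - int k * int (c' N k)"
    and e_le: "\<And>N k. e N k \<le> c N k"
    and e'_le: "\<And>N k. e' N k \<le> d'"
    and lower: "\<And>N k. int N * int d - int k * int u \<le> int N * int (e N k) - int k * int (c N k)"
    and nonneg': "\<And>N k. 0 \<le> int N * int (e' N k) - int k * int (c' N k)"
    and "0 < d" "d \<le> u"
  shows "\<exists>N k. 0 < c N (Suc k) \<and> d * c' N k \<le> d' * c N (Suc k)"
proof (rule ccontr)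
  assume "\<not> ?thesis"
  then have gt: "d' * c N (Suc k) < d * c' N k" if "0 < c N (Suc k)" for N k
    using that not_le by blast
  \<comment> \<open>Chosen so that \<open>m - 2\<close> exceeds the boundary loss
    \<open>2 * u * d'\<close>. With \<open>N = u * m\<close>, every level below \<open>m * d\<close>
    has a positive optimum and hence a nonzero maximizer.\<close>
  define m where "m = 2 * u * d' + 3"
  define N where "N = u * m"
  define v where "v k = int N * int (e N k) - int k * int (c N k)" for k
  define v' where "v' k = int N * int (e' N k) - int k * int (c' N k)" for k
  \<comment> \<open>Testing the optimum at level \<open>Suc k\<close> with the maximizer of level
    \<open>k\<close> bounds the drop of \<open>v\<close> above; for \<open>v'\<close> the opposite
    test bounds it below.\<close>
  have step: "v k - v (Suc k) \<le> int (c N k)" for k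
    using max[of N k "Suc k"] by (simp add: v_def algebra_simps)
  have step': "int (c' N (Suc k)) \<le> v' k - v' (Suc k)" for k
    using max'[of N "Suc k" k] by (simp add: v'_def algebra_simps)
  have sum': "(\<Sum>j<n. int (c' N (Suc j))) \<le> v' 0 - v' n" for n
  proof (induction n)
    case (Suc n)
    then show ?case
      using step'[of n] by simp
  qed simp
  \<comment> \<open>The sum starts at level 2 because level \<open>2 + j\<close> of \<open>c\<close>
    is compared with level \<open>Suc j\<close> of \<open>c'\<close>, and \<open>step'\<close>
    controls \<open>c'\<close> from level 1 on.\<close>
  have sum: "v 2 - v (2 + n) \<le> (\<Sum>j<n. int (c N (2 + j)))" for n
  proof (induction n)
    case (Suc n)
    then show ?case
      using step[of "2 + n"] by simp
  qed simp
  have "int N * int (e' N 0) \<le> int N * int d'"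
    using e'_le by (intro mult_left_mono) simp_all
  then have upper: "(\<Sum>j<N. int (c' N (Suc j))) \<le> int N * int d'"
    using sum'[of N] nonneg'[of N N] by (simp add: v'_def)
  have "int N * int (e N (2 + N)) \<le> int (2 + N) * int (c N (2 + N))"
    using e_le by (intro mult_mono) simp_all
  then have "v (2 + N) \<le> 0"
    by (simp add: v_def)
  then have low: "int N * int d - 2 * int u \<le> (\<Sum>j<N. int (c N (2 + j)))"
    using sum[of N] lower[of N 2] by (simp add: v_def)
  \<comment> \<open>If \<open>c\<close> vanished, so would \<open>e\<close> and the optimum,
    contradicting the positive lower bound at levels below \<open>m * d\<close>.\<close>
  have pos: "0 < c N (2 + j)" if "2 + j < m * d" for j
  proof (rule ccontr)
    assume "\<not> 0 < c N (2 + j)"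
    then have "int N * int d \<le> int (2 + j) * int u"
      using lower[of N "2 + j"] e_le[of N "2 + j"] by simp
    then have "u * (m * d) \<le> u * (2 + j)"
      unfolding N_def by (simp add: algebra_simps flip: of_nat_mult of_nat_add)
    moreover have "0 < u"
      using \<open>0 < d\<close> \<open>d \<le> u\<close> by simp
    ultimately have "m * d \<le> 2 + j"
      using mult_le_cancel1[of u "m * d" "2 + j"] by blast
    then show False
      using that by simp
  qed
  have "m * d \<le> N"
    using \<open>d \<le> u\<close> by (simp add: N_def mult.commute)
  have "m - 2 \<le> m * d - 2"
    using \<open>0 < d\<close> by (intro diff_le_mono) simp
  also have "\<dots> = card {..<m * d - 2}"
    by simp
  also have "\<dots> \<le> card {j \<in> {..<N}. 0 < c N (2 + j)}"
    using pos \<open>m * d \<le> N\<close> by (intro card_mono) auto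
  finally have "m - 2 \<le> card {j \<in> {..<N}. 0 < c N (2 + j)}" .
  moreover have "(\<Sum>j<N. of_bool (0 < c N (2 + j))) = int (card {j \<in> {..<N}. 0 < c N (2 + j)})"
    by (simp add: Int_def)
  ultimately have count: "int m - 2 \<le> (\<Sum>j<N. of_bool (0 < c N (2 + j)))"
    by linarith
  \<comment> \<open>A strict inequality of integers has a gap of at least one. These units, one for
    each nonzero level, outweigh the boundary loss.\<close>
  have "int d' * int (c N (2 + j)) + of_bool (0 < c N (2 + j)) \<le> int d * int (c' N (Suc j))" for j
    using gt[of N "Suc j"] by (cases "0 < c N (2 + j)") (simp_all flip: of_nat_mult)
  then have "(\<Sum>j<N. int d' * int (c N (2 + j)) + of_bool (0 < c N (2 + j)))
      \<le> (\<Sum>j<N. int d * int (c' N (Suc j)))"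
    by (intro sum_mono)
  then have "int d' * (\<Sum>j<N. int (c N (2 + j))) + (\<Sum>j<N. of_bool (0 < c N (2 + j)))
      \<le> int d * (\<Sum>j<N. int (c' N (Suc j)))"
    by (simp only: sum.distrib sum_distrib_left)
  moreover have "int d * (\<Sum>j<N. int (c' N (Suc j))) \<le> int d * (int N * int d')"
    by (intro mult_left_mono upper) simp
  moreover have "int d' * (int N * int d - 2 * int u) \<le> int d' * (\<Sum>j<N. int (c N (2 + j)))"
    by (intro mult_left_mono low) simp
  ultimately have "int m - 2 \<le> 2 * int u * int d'"
    using count by (simp add: algebra_simps)
  then show False
    by (simp add: m_def)
qed

section \<open>From the choice of a level to the dimension inequality\<close>

context cocommutative_hopf_module_coalgebra
begin

lemma finite_dimensional_act_span:
  assumes "finite_dimensional scaleH F" "finite_dimensional scaleM E"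
  shows "finite_dimensional scaleM (act_span scaleM act F E)"
proof -
  obtain A B where A: "finite A" "F = H.span A" and B: "finite B" "E = M.span B"
    using assms by (auto simp: finite_dimensional_def)
  let ?S = "(\<lambda>(a, b). act a b) ` (A \<times> B)"
  have "act a b \<in> M.span ?S" if "a \<in> F" "b \<in> E" for a b
  proof -
    interpret left: module_hom scaleH scaleM "\<lambda>h. act h b"
      unfolding module_hom_iff_linear by (rule act_linear_left)
    have "act a' b \<in> M.span ?S" if "a' \<in> A" for a'
    proof -
      interpret right: module_hom scaleM scaleM "act a'"
        unfolding module_hom_iff_linear by (rule act_linear_right)
      have "act a' b \<in> M.span (act a' ` B)"
        unfolding right.span_image using \<open>b \<in> E\<close> B(2) by blast
      moreover have "act a' ` B \<subseteq> ?S"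
        using that by auto
      ultimately show ?thesis
        using M.span_mono by blast
    qed
    then have "M.span ((\<lambda>h. act h b) ` A) \<subseteq> M.span ?S"
      by (intro M.span_minimal) auto
    moreover have "act a b \<in> M.span ((\<lambda>h. act h b) ` A)"
      unfolding left.span_image using \<open>a \<in> F\<close> A(2) by blast
    ultimately show ?thesis
      by blast
  qed
  then have sub: "act_span scaleM act F E \<subseteq> M.span ?S"
    unfolding act_span_def by (intro M.span_minimal) auto
  have "finite_dimensional scaleM (M.span ?S)"
    unfolding finite_dimensional_def using A(1) B(1) by (intro exI[of _ ?S]) simp
  then show ?thesis
    by (rule M.finite_dimensional_subset[OF _ _ sub]) (simp add: act_span_def)
qed

text \<open>Transport is used twice: the one-by-one comatrix \<open>1\<close> gives \<open>C\<close>
  inside \<open>C'\<close>, and the matrix coefficients of \<open>F\<close> give the same for the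
  products, since they span \<open>F\<close> by the counit.\<close>

lemma transport_act_span:
  assumes F: "subcoalgebra scaleH \<Delta>H F" "finite_dimensional scaleH F"
    and E: "M.subspace E"
    and C: "stable scaleM (contractions \<Delta>M scaleM) C" "finite_dimensional scaleM C"
    and C': "stable scaleM (contractions \<Delta>M scaleM) C'" "finite_dimensional scaleM C'"
    and max: "\<And>D. stable scaleM (contractions \<Delta>M scaleM) D \<Longrightarrow> finite_dimensional scaleM D \<Longrightarrow>
      int N * int (M.dim (E \<inter> D)) - int k * int (M.dim D)
      \<le> int N * int (M.dim (E \<inter> C)) - int k * int (M.dim C)"
    and max': "\<And>D. stable scaleM (contractions \<Delta>M scaleM) D \<Longrightarrow> finite_dimensional scaleM D \<Longrightarrow>
      int N * int (M.dim ((E + act_span scaleM act F E) \<inter> D)) - int k' * int (M.dim D)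
      \<le> int N * int (M.dim ((E + act_span scaleM act F E) \<inter> C')) - int k' * int (M.dim C')"
    and "k' < k"
  shows "C + act_span scaleM act F C \<subseteq> C'"
proof -
  let ?E' = "E + act_span scaleM act F E"
  have subF: "M.subspace (act_span scaleM act F E)"
    by (simp add: act_span_def)
  have E': "M.subspace ?E'"
    by (rule M.subspace_set_plus[OF E subF])
  have subC': "M.subspace C'"
    using C'(1) by (simp add: stable_def)
  have E_E': "x \<in> ?E'" if "x \<in> E" for x
    using set_plus_intro[OF that M.subspace_0[OF subF]] by simp
  have FE_E': "act a x \<in> ?E'" if "a \<in> F" "x \<in> E" for a x
  proof -
    have "act a x \<in> act_span scaleM act F E"
      unfolding act_span_def using that by (intro M.span_base) blast
    then show ?thesis
      using set_plus_intro[OF M.subspace_0[OF E]] by force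
  qed
  have "c \<in> C'" if "c \<in> C" for c
  proof -
    \<comment> \<open>The unit is grouplike and thus a comatrix of size one; it is written as a
      function of two indices to match the shape of \<open>T i j\<close>.\<close>
    have "act ((\<lambda>i j. 1) () ()) c \<in> C'"
    proof (rule transport_coefficients[where I = "{()}" and T = "\<lambda>i j. 1" and E = E and E' = ?E'
          and C = C and N = N and k = k and k' = k'])
      show "sweedler \<Delta>H scaleM \<beta> 1 = (\<Sum>l\<in>{()}. \<beta> 1 1)" if "bilinear_map scaleH scaleM \<beta>" for \<beta>
        using H.sweedler_eq[OF that H.comult_one] by (simp add: lin_ext_single[OF M.vector_space_scale])
      show "(\<Sum>l\<in>{()}. S 1 * 1) = (if i = j then 1 else 0)" for i j :: unit
        using H.antipode_left[OF H.comult_one]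
        by (simp add: lin_ext_single[OF H.vector_space_scale] H.counit_one)
    qed (simp_all add: E_E' act_one that E E' C C' max max' \<open>k' < k\<close>)
    then show ?thesis
      by (simp add: act_one)
  qed
  moreover have "act a c \<in> C'" if "a \<in> F" "c \<in> C" for a c
  proof -
    obtain I e where I: "finite I" "I \<subseteq> F" "H.span I = F"
      and e: "\<And>i. Vector_Spaces.linear scaleH (*) (e i)"
      and dual: "\<And>a. a \<in> F \<Longrightarrow> (\<Sum>i\<in>I. scaleH (e i a) i) = a"
      and e_basis: "\<And>i j. j \<in> I \<Longrightarrow> e i j = (if i = j then 1 else 0)"
      using H.dual_basis[OF F(2)] by blast
    define T where "T i j = contract_left \<Delta>H scaleH (e i) j" for i j
    have T_F: "T i j \<in> F" if "j \<in> F" for i j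
      using H.subcoalgebra_imp_stable[OF F(1)] that e[of i]
      unfolding stable_def contractions_def T_def by blast
    have T_C: "act (T i j) c \<in> C'" if "i \<in> I" "j \<in> I" for i j
    proof (rule transport_coefficients[where I = I and T = T and E = E and E' = ?E'
          and C = C and N = N and k = k and k' = k'])
      show "sweedler \<Delta>H scaleM \<beta> (T i j) = (\<Sum>l\<in>I. \<beta> (T i l) (T l j))"
        if "bilinear_map scaleH scaleM \<beta>" "i \<in> I" "j \<in> I" for \<beta> i j
        unfolding T_def using I(2) that by (intro H.sweedler_coefficient[OF F(1) e dual]) auto
      show "(\<Sum>l\<in>I. S (T i l) * T l j) = (if i = j then 1 else 0)" if "i \<in> I" "j \<in> I" for i j
      proof -
        have bil: "bilinear_map scaleH scaleH (\<lambda>a b. S a * b)"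
          by (rule bilinear_mapI[OF H.vector_space_scale H.vector_space_scale])
            (simp_all add: linearD(1,2)[OF H.antipode_linear] algebra_simps
              H.scale_mult_left H.scale_mult_right)
        \<comment> \<open>By the comatrix law this is the antipode axiom at \<open>T i j\<close>;
          the counit of \<open>T i j\<close> is then \<open>e i j\<close>.\<close>
        have "(\<Sum>l\<in>I. S (T i l) * T l j) = sweedler \<Delta>H scaleH (\<lambda>a b. S a * b) (T i j)"
          unfolding T_def using I(2) that
          by (intro H.sweedler_coefficient[OF F(1) e dual bil, symmetric]) auto
        also have "\<dots> = scaleH (\<epsilon>H (T i j)) 1"
          unfolding sweedler_def by (rule H.antipode_left[OF H.comult_nonempty])
        also have "\<epsilon>H (T i j) = sweedler \<Delta>H (*) (\<lambda>a b. e i a * \<epsilon>H b) j"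
          unfolding T_def contract_left_def linear_sweedler_comp[OF H.counit_linear]
          by (simp add: linearD(2)[OF H.counit_linear])
        also have "\<dots> = e i (sweedler \<Delta>H scaleH (\<lambda>a b. scaleH (\<epsilon>H b) a) j)"
          unfolding linear_sweedler_comp[OF e] by (simp add: linearD(2)[OF e] mult.commute)
        also have "\<dots> = (if i = j then 1 else 0)"
          using that by (simp add: H.sweedler_counit_right e_basis)
        finally show ?thesis
          by (simp split: if_splits)
      qed
      show "act (T i j) x \<in> ?E'" if "i \<in> I" "j \<in> I" "x \<in> E" for i j x
        using that I(2) by (intro FE_E' T_F) auto
    qed (fact I E E' C C' max max' \<open>k' < k\<close> that \<open>c \<in> C\<close>)+
    have "act j c \<in> C'" if "j \<in> I" for j
    proof -
      \<comment> \<open>The counit axiom writes the basis element \<open>j\<close> as a combination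
        of the coefficients in its column, whose actions are already controlled.\<close>
      have "sweedler \<Delta>H scaleH (\<lambda>a b. scaleH (\<epsilon>H a) b) j = (\<Sum>i\<in>I. scaleH (\<epsilon>H i) (T i j))"
        unfolding T_def using I(2) that
        by (intro H.sweedler_dual_basis[OF F(1) e dual H.bilinear_contract(2)[OF H.counit_linear]]) auto
      then have "act j c = act (\<Sum>i\<in>I. scaleH (\<epsilon>H i) (T i j)) c"
        by (simp only: H.sweedler_counit_left)
      then have "act j c = (\<Sum>i\<in>I. scaleM (\<epsilon>H i) (act (T i j) c))"
        by (simp only: act_simps)
      then show ?thesis
        using T_C that by (auto intro!: M.subspace_sum[OF subC'] M.subspace_scale[OF subC'])
    qed
    moreover have "act (\<Sum>j\<in>I. scaleH (e j a) j) c = (\<Sum>j\<in>I. scaleM (e j a) (act j c))"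
      by (simp only: act_simps)
    then have "act a c = (\<Sum>j\<in>I. scaleM (e j a) (act j c))"
      by (simp only: dual[OF \<open>a \<in> F\<close>])
    ultimately show ?thesis
      by (auto intro!: M.subspace_sum[OF subC'] M.subspace_scale[OF subC'])
  qed
  then have "act_span scaleM act F C \<subseteq> C'"
    unfolding act_span_def by (intro M.span_minimal subC') auto
  ultimately show ?thesis
    by (intro M.set_plus_subset_subspace subC') auto
qed

text \<open>Maximizers for \<open>E\<close> and for \<open>E'\<close> are fixed at all levels.
  Averaging finds adjacent levels with the right ratio of dimensions, and transport puts the
  numerator for \<open>E\<close> inside the maximizer for \<open>E'\<close>.\<close>

lemma exists_subcoalgebra_dim_le:
  assumes F: "subcoalgebra scaleH \<Delta>H F" "finite_dimensional scaleH F"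
    and E: "finite_dimensional scaleM E" "E \<noteq> {0}"
  obtains C where "subcoalgebra scaleM \<Delta>M C" "finite_dimensional scaleM C" "0 < M.dim C"
    "M.dim E * M.dim (C + act_span scaleM act F C) \<le> M.dim (E + act_span scaleM act F E) * M.dim C"
proof -
  let ?P = "contractions \<Delta>M scaleM"
  let ?st = "\<lambda>D. stable scaleM ?P D \<and> finite_dimensional scaleM D"
  define E' where "E' = E + act_span scaleM act F E"
  have fdE': "finite_dimensional scaleM E'"
    unfolding E'_def by (intro M.finite_dimensional_sum E finite_dimensional_act_span F)
  define val where "val X N k D = int N * int (M.dim (X \<inter> D)) - int k * int (M.dim D)" for X N k D
  have "\<exists>C. ?st C \<and> (\<forall>D. ?st D \<longrightarrow> val E N k D \<le> val E N k C)" for N k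
    unfolding val_def by (rule M.ex_stable_maximizer[where P = ?P and E = E and N = N and k = k]) (use M.linear_contractions E(1) in blast)+
  then obtain C where C: "\<And>N k. ?st (C N k)" "\<And>N k D. ?st D \<Longrightarrow> val E N k D \<le> val E N k (C N k)"
    by metis
  have "\<exists>C. ?st C \<and> (\<forall>D. ?st D \<longrightarrow> val E' N k D \<le> val E' N k C)" for N k
    unfolding val_def by (rule M.ex_stable_maximizer[where P = ?P and E = E' and N = N and k = k]) (use M.linear_contractions fdE' in blast)+
  then obtain C' where C': "\<And>N k. ?st (C' N k)" "\<And>N k D. ?st D \<Longrightarrow> val E' N k D \<le> val E' N k (C' N k)"
    by metis
  obtain B where B: "finite B" "M.span B = E"
    using M.finite_dimensional_basis[OF E(1)] by blast
  \<comment> \<open>As a test space containing \<open>E\<close>, \<open>U\<close> supplies the lower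
    bound on the optimum for \<open>E\<close>; the zero space supplies nonnegativity for
    \<open>E'\<close>.\<close>
  obtain U where U: "?st U" "B \<subseteq> U"
    using M.stable_contractions_finite[OF B(1)] by blast
  have "E \<subseteq> U"
    using M.span_minimal[OF U(2)] U(1) B(2) by (simp add: stable_def)
  then have "E \<inter> U = E"
    by blast
  have zero: "?st {0}"
    using M.stable_singleton_0[OF M.linear_contractions] M.finite_dimensional_singleton_0 by blast
  have "\<exists>N k. 0 < M.dim (C N (Suc k)) \<and> M.dim E * M.dim (C' N k) \<le> M.dim E' * M.dim (C N (Suc k))"
  proof (rule exists_level[where e = "\<lambda>N k. M.dim (E \<inter> C N k)" and e' = "\<lambda>N k. M.dim (E' \<inter> C' N k)"
        and u = "M.dim U"])
    fix N k l
    show "int N * int (M.dim (E \<inter> C N l)) - int k * int (M.dim (C N l))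
        \<le> int N * int (M.dim (E \<inter> C N k)) - int k * int (M.dim (C N k))"
      using C(2)[OF C(1)] by (simp add: val_def)
    show "int N * int (M.dim (E' \<inter> C' N l)) - int k * int (M.dim (C' N l))
        \<le> int N * int (M.dim (E' \<inter> C' N k)) - int k * int (M.dim (C' N k))"
      using C'(2)[OF C'(1)] by (simp add: val_def)
    show "M.dim (E \<inter> C N k) \<le> M.dim (C N k)"
      using C(1) by (intro M.dim_mono_finite_dimensional) auto
    show "M.dim (E' \<inter> C' N k) \<le> M.dim E'"
      by (rule M.dim_mono_finite_dimensional[OF fdE']) simp
    show "int N * int (M.dim E) - int k * int (M.dim U)
        \<le> int N * int (M.dim (E \<inter> C N k)) - int k * int (M.dim (C N k))"
      using C(2)[OF U(1), of N k] by (simp add: val_def \<open>E \<inter> U = E\<close>)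
    have "E' \<inter> {0} = {0}"
      using M.subspace_0[OF M.finite_dimensional_imp_subspace[OF fdE']] by blast
    then show "0 \<le> int N * int (M.dim (E' \<inter> C' N k)) - int k * int (M.dim (C' N k))"
      using C'(2)[OF zero, of N k] by (simp add: val_def M.dim_singleton_0)
    show "0 < M.dim E"
      by (rule M.dim_pos[OF E])
    show "M.dim E \<le> M.dim U"
      using U(1) \<open>E \<subseteq> U\<close> by (intro M.dim_mono_finite_dimensional) auto
  qed
  then obtain N k where Nk: "0 < M.dim (C N (Suc k))"
    "M.dim E * M.dim (C' N k) \<le> M.dim E' * M.dim (C N (Suc k))"
    by blast
  \<comment> \<open>Transport requires a strictly smaller level for \<open>E'\<close>, which is why
    the averaging compares level \<open>Suc k\<close> with level \<open>k\<close>.\<close>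
  have "C N (Suc k) + act_span scaleM act F (C N (Suc k)) \<subseteq> C' N k"
  proof (rule transport_act_span[OF F M.finite_dimensional_imp_subspace[OF E(1)], where N = N and k = "Suc k" and k' = k])
    show "stable scaleM ?P (C N (Suc k))" "finite_dimensional scaleM (C N (Suc k))"
      "stable scaleM ?P (C' N k)" "finite_dimensional scaleM (C' N k)"
      using C(1) C'(1) by simp_all
    fix D assume D: "stable scaleM ?P D" "finite_dimensional scaleM D"
    show "int N * int (M.dim (E \<inter> D)) - int (Suc k) * int (M.dim D)
        \<le> int N * int (M.dim (E \<inter> C N (Suc k))) - int (Suc k) * int (M.dim (C N (Suc k)))"
      using C(2)[of D N "Suc k"] D unfolding val_def by blast
    show "int N * int (M.dim ((E + act_span scaleM act F E) \<inter> D)) - int k * int (M.dim D)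
        \<le> int N * int (M.dim ((E + act_span scaleM act F E) \<inter> C' N k)) - int k * int (M.dim (C' N k))"
      using C'(2)[of D N k] D unfolding val_def E'_def by blast
  qed simp
  then have "M.dim (C N (Suc k) + act_span scaleM act F (C N (Suc k))) \<le> M.dim (C' N k)"
    using C'(1) by (intro M.dim_mono_finite_dimensional) auto
  then have "M.dim E * M.dim (C N (Suc k) + act_span scaleM act F (C N (Suc k)))
      \<le> M.dim E' * M.dim (C N (Suc k))"
    using Nk(2) mult_le_mono2 order_trans by blast
  then show thesis
    using that[of "C N (Suc k)"] C(1) Nk(1) M.stable_imp_subcoalgebra unfolding E'_def by blast
qed

end

theorem theorem1p1:
  fixes scaleH :: "'k::field \<Rightarrow> 'h::ring_1 \<Rightarrow> 'h"
    and \<Delta>H :: "'h \<Rightarrow> ('h \<times> 'h \<Rightarrow>\<^sub>0 'k) set"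
    and \<epsilon>H :: "'h \<Rightarrow> 'k"
    and S :: "'h \<Rightarrow> 'h"
    and scaleM :: "'k \<Rightarrow> 'm::ab_group_add \<Rightarrow> 'm"
    and \<Delta>M :: "'m \<Rightarrow> ('m \<times> 'm \<Rightarrow>\<^sub>0 'k) set"
    and \<epsilon>M :: "'m \<Rightarrow> 'k"
    and act :: "'h \<Rightarrow> 'm \<Rightarrow> 'm"
    and F :: "'h set"
    and E :: "'m set"
  assumes "hopf_algebra scaleH \<Delta>H \<epsilon>H S"
    and "cocommutative \<Delta>H"
    and "module_coalgebra scaleH \<Delta>H \<epsilon>H scaleM \<Delta>M \<epsilon>M act"
    and "subcoalgebra scaleH \<Delta>H F" and "finite_dimensional scaleH F"
    and "module.subspace scaleM E" and "finite_dimensional scaleM E" and "E \<noteq> {0}"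
  shows "\<exists>C. subcoalgebra scaleM \<Delta>M C \<and> finite_dimensional scaleM C \<and> C \<noteq> {0} \<and>
           real (vector_space.dim scaleM (C + act_span scaleM act F C)) / real (vector_space.dim scaleM C)
           \<le> real (vector_space.dim scaleM (E + act_span scaleM act F E)) / real (vector_space.dim scaleM E)"
proof -
  interpret cocommutative_hopf_module_coalgebra scaleH \<Delta>H \<epsilon>H scaleM \<Delta>M \<epsilon>M act S
    by (intro cocommutative_hopf_module_coalgebra.intro
        cocommutative_hopf_module_coalgebra_axioms.intro assms)
  let ?E' = "E + act_span scaleM act F E"
  obtain C where C: "subcoalgebra scaleM \<Delta>M C" "finite_dimensional scaleM C" "0 < M.dim C"
    and le: "M.dim E * M.dim (C + act_span scaleM act F C) \<le> M.dim ?E' * M.dim C"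
    using exists_subcoalgebra_dim_le[OF assms(4,5,7,8)] by blast
  have "0 < M.dim E"
    by (rule M.dim_pos[OF assms(7,8)])
  moreover have "real (M.dim E) * real (M.dim (C + act_span scaleM act F C))
      \<le> real (M.dim ?E') * real (M.dim C)"
    using le by (simp only: of_nat_mult[symmetric] of_nat_le_iff)
  ultimately have "real (M.dim (C + act_span scaleM act F C)) / real (M.dim C)
      \<le> real (M.dim ?E') / real (M.dim E)"
    using C(3) by (simp add: divide_simps mult.commute)
  moreover have "C \<noteq> {0}"
    using C(3) M.dim_singleton_0 by auto
  ultimately show ?thesis
    using C(1,2) by blast
qed

end
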